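(* Let $N > 0$ be an integer and let $0 \leqslant n_0 < \dots < n_{N-1} < M < n_N < \dots < n_{2N-1}$ be real numbers, such that each of $n_0,\dots,n_{N-2}$ is either a non-negative integer, greater than $N-2$, or both. Let $c_{n_0},\dots,c_{n_{2N-1}}$ be positive reals. Then there exists a negative number $c_M$ such that $$x \mapsto c_{n_0} x^{n_0} + c_{n_1} x^{n_1} + \dots + c_{n_{N-1}} x^{n_{N-1}} + c_M x^M + c_{n_N} x^{n_N} + \dots + c_{n_{2N-1}} x^{n_{2N-1}}$$ entrywise preserves positivity on $\mathbb{P}_N((0,+\infty))$.
   Context: For $I \subset \mathbb{C}$, $\mathbb{P}_N(I)$ denotes the set of positive semidefinite Hermitian $N\times N$ matrices all of whose entries lie in $I$. For a function $f$ on $I$ and $A=(a_{jk})$ with entries in $I$, $f[A] := (f(a_{jk}))$ is the entrywise application. The function $f$ entrywise preserves positivity on $\mathbb{P}_N(I)$ if $f[A]$ is positive semidefinite for every $A \in \mathbb{P}_N(I)$. *)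

theory Defs
  imports "HOL-Analysis.Complex_Transcendental" "Jordan_Normal_Form.Schur_Decomposition"
begin

(* The quadratic form v* A v is written (A v) \<bullet>c v; it is automatically real
   when A is Hermitian, so only its real part is constrained. *)
definition psd_mat :: "nat \<Rightarrow> complex mat \<Rightarrow> bool" where
  "psd_mat N A \<longleftrightarrow> A \<in> carrier_mat N N \<and> mat_adjoint A = A \<and>
     (\<forall>v \<in> carrier_vec N. 0 \<le> Re ((A *\<^sub>v v) \<bullet>c v))"

definition psd_with_entries :: "nat \<Rightarrow> complex set \<Rightarrow> complex mat set" where
  "psd_with_entries N I = {A. psd_mat N A \<and> elements_mat A \<subseteq> I}"

definition entrywise_preserves_positivity ::
    "nat \<Rightarrow> complex set \<Rightarrow> (complex \<Rightarrow> complex) \<Rightarrow> bool" where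
  "entrywise_preserves_positivity N I f \<longleftrightarrow>
     (\<forall>A \<in> psd_with_entries N I. psd_mat N (map_mat f A))"

end

theory Submission
  imports Defs
begin

text \<open>
Write $P_s$ for the matrix with entries $(u_i u_j)^s$, where $u$ is a positive vector. For the
rank one matrix with entries $u_i u_j$ the claim says that $\epsilon P_M$ is dominated by
$\sum_j c_j P_{n_j}$, that is,
$\epsilon\, g(M)^2 \le \sum_j c_j\, g(n_j)^2$ for every vector $v$, where
$g(s) = \sum_i v_i u_i^s$. By the Cauchy--Schwarz inequality it suffices that
$g(M) = \sum_j b_j\, g(n_j)$ with coefficients $b_j$ bounded independently of $u$ and $v$, and this
holds if $x^M = \sum_j b_j x^{n_j}$ at the at most $N$ points $x = u_i$. Thus everything rests on
interpolating $x^M$ at $N$ arbitrary positive nodes with uniformly bounded coefficients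
(\<open>bounded_interpolation\<close>).

The boundedness is a matter of choosing exponents. If $p$ nodes are at most $1$ and $q$ exceed $1$,
then $p$ exponents below $M$ and $q$ exponents above $M$ are used, so that $x^M$ minus its interpolant is a sum
of $p+q+1$ powers with $p+q$ positive zeros. By Rolle's theorem the coefficients of such a sum
strictly alternate in sign (\<open>alternating_coeffs\<close>). Consequently deleting the largest exponent and one of
the zeros can only enlarge the coefficients below $M$ (\<open>coeff_le_of_truncation\<close>), because the
difference of the two sums alternates as well. After $q$ deletions only exponents up to $M$ and zeros in
$(0,1]$ remain, where differentiation gives a bound by induction
(\<open>coeffs_bounded_unit_interval\<close>). The coefficients above $M$ are treated by $x \mapsto 1/x$.

The passage from rank one to arbitrary matrices is by induction on the dimension, as in the
work of FitzGerald and Horn (\<open>preserves_psd_Suc\<close>): subtracting from $A$ the rank one matrix that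
has the same last row and column leaves a positive semidefinite matrix $B$ which vanishes there, and
along the segment between the two matrices $f$ changes at the rate of the Schur product of $B$ with
$f'$ applied entrywise. Only $f'$ in dimension $N-1$ matters, and $f'$ is again of the form in the theorem
once its smallest and its largest exponent are split off; those two terms preserve positivity on their own
(\<open>preserves_psd_powr\<close>). This is where the condition on the exponents enters.
\<close>

section \<open>Real quadratic forms, Schur complements and Schur products\<close>

text \<open>Matrices are functions on pairs of indices, and only the entries with indices below the dimension matter.
This lets the inductions on the dimension pass to a leading block without changing the matrix.\<close>

definition qform :: "nat \<Rightarrow> (nat \<Rightarrow> nat \<Rightarrow> real) \<Rightarrow> (nat \<Rightarrow> real) \<Rightarrow> real" where
  "qform N A v = (\<Sum>i<N. \<Sum>j<N. v i * v j * A i j)"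

definition real_psd :: "nat \<Rightarrow> (nat \<Rightarrow> nat \<Rightarrow> real) \<Rightarrow> bool" where
  "real_psd N A \<longleftrightarrow> (\<forall>i<N. \<forall>j<N. A i j = A j i) \<and> (\<forall>v. 0 \<le> qform N A v)"

lemma real_psdD:
  assumes "real_psd N A"
  shows "\<And>i j. i < N \<Longrightarrow> j < N \<Longrightarrow> A i j = A j i" "\<And>v. 0 \<le> qform N A v"
  using assms unfolding real_psd_def by blast+

lemma real_psd_0 [simp]: "real_psd 0 A"
  by (simp add: real_psd_def qform_def)

lemma qform_cong:
  "(\<And>i j. i < N \<Longrightarrow> j < N \<Longrightarrow> A i j = B i j) \<Longrightarrow> (\<And>i. i < N \<Longrightarrow> v i = w i) \<Longrightarrow>
     qform N A v = qform N B w"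
  by (simp add: qform_def)

lemma qform_add: "qform N (\<lambda>i j. A i j + B i j) v = qform N A v + qform N B v"
  by (simp add: qform_def distrib_left sum.distrib)

lemma qform_scale: "qform N (\<lambda>i j. t * A i j) v = t * qform N A v"
  by (simp add: qform_def sum_distrib_left mult_ac)

lemma qform_sum: "qform N (\<lambda>i j. \<Sum>k\<in>K. A k i j) v = (\<Sum>k\<in>K. qform N (A k) v)"
proof (cases "finite K")
  case True
  then show ?thesis
    by (induction K rule: finite_induct) (simp_all add: qform_add qform_def[where A = "\<lambda>_ _. 0"])
qed (simp add: qform_def)

lemma qform_rank_one: "qform N (\<lambda>i j. z i * z j * A i j) v = qform N A (\<lambda>i. z i * v i)"
  by (simp add: qform_def mult_ac)

lemma qform_outer_product: "qform N (\<lambda>i j. z i * z j) v = (\<Sum>i<N. v i * z i)\<^sup>2"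
  by (simp add: qform_def power2_eq_square sum_product mult_ac)

lemma real_psd_add: "real_psd N A \<Longrightarrow> real_psd N B \<Longrightarrow> real_psd N (\<lambda>i j. A i j + B i j)"
  by (simp add: real_psd_def qform_add)

lemma real_psd_scale: "real_psd N A \<Longrightarrow> t \<ge> 0 \<Longrightarrow> real_psd N (\<lambda>i j. t * A i j)"
  by (simp add: real_psd_def qform_scale)

lemma real_psd_outer_product: "real_psd N (\<lambda>i j. z i * z j)"
  by (simp add: real_psd_def qform_outer_product mult.commute)

lemma qform_vanishing_border:
  assumes "\<And>i. i \<le> N \<Longrightarrow> A i N = 0" "\<And>i. i \<le> N \<Longrightarrow> A N i = 0"
  shows "qform (Suc N) A v = qform N A v"
  using assms by (simp add: qform_def)

lemma qform_zero_last: "qform (Suc N) A (v(N := 0)) = qform N A v"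
  by (simp add: qform_def)

lemma real_psd_leading_block:
  assumes "real_psd (Suc N) A" shows "real_psd N A"
  using assms qform_zero_last[of N A] unfolding real_psd_def by (metis less_SucI)

text \<open>The restriction of the form to a line in the direction of the last unit vector. Minimising over \<open>t\<close>
gives Schur complements. If the last diagonal entry is zero, the form is affine in \<open>t\<close>, and being
bounded below forces the last row and column to vanish.\<close>

lemma qform_diff_last:
  assumes "\<And>i. i \<le> N \<Longrightarrow> A N i = A i N"
  shows "qform (Suc N) A (\<lambda>i. v i - (if i = N then t else 0))
       = qform (Suc N) A v - 2 * t * (\<Sum>i\<le>N. v i * A i N) + t\<^sup>2 * A N N"
proof -
  let ?d = "\<lambda>i. if i = N then t else 0"
  have "qform (Suc N) A (\<lambda>i. v i - ?d i)
      = (\<Sum>i\<le>N. \<Sum>j\<le>N. v i * v j * A i j - ?d i * (v j * A i j) - ?d j * (v i * A i j)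
            + ?d i * (?d j * A i j))"
    by (auto simp: qform_def lessThan_Suc_atMost algebra_simps intro!: sum.cong)
  also have "\<dots> = qform (Suc N) A v - (\<Sum>i\<le>N. ?d i * (\<Sum>j\<le>N. v j * A i j))
        - (\<Sum>i\<le>N. \<Sum>j\<le>N. ?d j * (v i * A i j)) + (\<Sum>i\<le>N. ?d i * (\<Sum>j\<le>N. ?d j * A i j))"
    by (simp only: sum.distrib sum_subtractf sum_distrib_left qform_def lessThan_Suc_atMost)
  also have "\<dots> = qform (Suc N) A v - t * (\<Sum>j\<le>N. v j * A N j)
        - (\<Sum>i\<le>N. t * (v i * A i N)) + t\<^sup>2 * A N N"
    by (simp add: if_distrib[where f = "\<lambda>x. x * _"] sum.delta power2_eq_square cong: if_cong)
  also have "(\<Sum>j\<le>N. v j * A N j) = (\<Sum>i\<le>N. v i * A i N)"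
    using assms by simp
  finally show ?thesis by (simp add: sum_distrib_left algebra_simps)
qed

lemma qform_unit_vector:
  assumes "k < N" shows "qform N A (\<lambda>i. if i = k then 1 else 0) = A k k"
proof -
  have "(\<Sum>j<N. (if i = k then 1 else 0) * (if j = k then 1 else 0) * A i j)
      = (if i = k then A k k else 0)" for i
    using assms by (cases "i = k") (simp_all add: if_distrib[where f = "\<lambda>x. x * _"] cong: if_cong)
  then show ?thesis using assms by (simp add: qform_def)
qed

lemma real_psd_diag:
  assumes "real_psd N A" "k < N" shows "A k k \<ge> 0"
  using real_psdD(2)[OF assms(1)] qform_unit_vector[OF assms(2), of A] by metis

lemma real_psd_zero_last_diag:
  assumes "real_psd (Suc N) A" "A N N = 0" "k \<le> N"
  shows "A k N = 0" "A N k = 0"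
proof -
  have sym: "A N i = A i N" if "i \<le> N" for i
    using real_psdD(1)[OF assms(1)] that by simp
  show "A k N = 0"
  proof (rule ccontr)
    assume ne: "A k N \<noteq> 0"
    let ?v = "\<lambda>i. if i = k then 1 else 0 :: real"
    have q: "qform (Suc N) A ?v = A k k"
      using assms(3) by (intro qform_unit_vector) simp
    have l: "(\<Sum>i\<le>N. ?v i * A i N) = A k N"
      using assms(3) by (simp add: if_distrib[where f = "\<lambda>x. x * _"] sum.delta cong: if_cong)
    \<comment> \<open>this choice turns the quadratic form, affine in t, into -1\<close>
    define t where "t = (A k k + 1) / (2 * A k N)"
    have "0 \<le> qform (Suc N) A (\<lambda>i. ?v i - (if i = N then t else 0))"
      by (rule real_psdD(2)[OF assms(1)])
    also have "\<dots> = A k k - 2 * t * A k N + t\<^sup>2 * A N N"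
      by (subst qform_diff_last) (simp only: sym, simp only: q l)
    finally have "0 \<le> A k k - 2 * t * A k N + t\<^sup>2 * A N N" .
    then show False using ne assms(2) by (simp add: t_def)
  qed
  then show "A N k = 0" using sym assms(3) by simp
qed

text \<open>The subtracted rank one matrix agrees with \<open>A\<close> in the last row and column. The form of the difference at
\<open>v\<close> is the minimum of the form of \<open>A\<close> over all changes of the last coordinate of \<open>v\<close>.\<close>

lemma schur_complement_psd:
  assumes "real_psd (Suc N) A" "A N N > 0"
  shows "real_psd (Suc N) (\<lambda>i j. A i j - A i N * A j N / A N N)"
proof -
  have sym: "A N i = A i N" if "i \<le> N" for i
    using real_psdD(1)[OF assms(1)] that by simp
  have "0 \<le> qform (Suc N) (\<lambda>i j. A i j - A i N * A j N / A N N) v" for v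
  proof -
    define s where "s = (\<Sum>i\<le>N. v i * A i N)"
    have "qform (Suc N) (\<lambda>i j. A i j + (- 1 / A N N) * (A i N * A j N)) v
        = qform (Suc N) A v - s\<^sup>2 / A N N"
      by (simp only: qform_add qform_scale qform_outer_product s_def lessThan_Suc_atMost) simp
    also have "\<dots> = qform (Suc N) A (\<lambda>i. v i - (if i = N then s / A N N else 0))"
      using assms(2) by (simp add: qform_diff_last[where A = A and N = N, OF sym] s_def[symmetric] power2_eq_square)
    also have "\<dots> \<ge> 0" using real_psdD(2)[OF assms(1)] .
    finally show ?thesis by simp
  qed
  then show ?thesis
    using real_psdD(1)[OF assms(1)] by (simp add: real_psd_def mult.commute)
qed

text \<open>Induction on the dimension: \<open>B\<close> is the sum of a rank one matrix, whose Schur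
product with \<open>A\<close> is a diagonal congruence of \<open>A\<close>, and of its Schur complement, which lives in the
leading block and is covered by the induction hypothesis.\<close>

theorem schur_product:
  assumes "real_psd N A" "real_psd N B"
  shows "real_psd N (\<lambda>i j. A i j * B i j)"
  using assms
proof (induction N arbitrary: B)
  case 0
  then show ?case by simp
next
  case (Suc N)
  have border: "real_psd (Suc N) (\<lambda>i j. A i j * C i j)"
    if C: "real_psd (Suc N) C" "\<And>i. i \<le> N \<Longrightarrow> C i N = 0 \<and> C N i = 0" for C
  proof -
    have "real_psd N (\<lambda>i j. A i j * C i j)"
      using Suc.IH Suc.prems(1) C(1) real_psd_leading_block by blast
    moreover have "qform (Suc N) (\<lambda>i j. A i j * C i j) v = qform N (\<lambda>i j. A i j * C i j) v" for v
      by (rule qform_vanishing_border) (use C(2) in auto)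
    ultimately show ?thesis
      using real_psdD(1)[OF Suc.prems(1)] real_psdD(1)[OF C(1)] by (simp add: real_psd_def)
  qed
  show ?case
  proof (cases "B N N = 0")
    case True
    then show ?thesis using border[OF Suc.prems(2)] real_psd_zero_last_diag[OF Suc.prems(2)] by blast
  next
    case False
    then have pos: "B N N > 0" using real_psd_diag[OF Suc.prems(2), of N] by simp
    let ?C = "\<lambda>i j. B i j - B i N * B j N / B N N"
    have "real_psd (Suc N) (\<lambda>i j. A i j * ?C i j)"
      using pos real_psdD(1)[OF Suc.prems(2)]
      by (intro border schur_complement_psd[OF Suc.prems(2) pos]) simp_all
    moreover have "real_psd (Suc N) (\<lambda>i j. (1 / B N N) * (B i N * B j N * A i j))"
      using pos real_psdD[OF Suc.prems(1)]
      by (intro real_psd_scale) (auto simp: real_psd_def qform_rank_one)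
    ultimately have "real_psd (Suc N)
        (\<lambda>i j. A i j * ?C i j + (1 / B N N) * (B i N * B j N * A i j))"
      by (rule real_psd_add)
    then show ?thesis by (simp add: algebra_simps)
  qed
qed

section \<open>The induction on the dimension for entrywise preservers\<close>

definition preserves_psd :: "nat \<Rightarrow> (real \<Rightarrow> real) \<Rightarrow> bool" where
  "preserves_psd N f \<longleftrightarrow>
     (\<forall>A. real_psd N A \<and> (\<forall>i<N. \<forall>j<N. A i j > 0) \<longrightarrow> real_psd N (\<lambda>i j. f (A i j)))"

lemma preserves_psd_0 [simp]: "preserves_psd 0 f"
  by (simp add: preserves_psd_def)

lemma preserves_psd_add:
  "preserves_psd N f \<Longrightarrow> preserves_psd N g \<Longrightarrow> preserves_psd N (\<lambda>x. f x + g x)"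
  by (simp add: preserves_psd_def real_psd_add)

lemma preserves_psd_scale: "preserves_psd N f \<Longrightarrow> t \<ge> 0 \<Longrightarrow> preserves_psd N (\<lambda>x. t * f x)"
  by (simp add: preserves_psd_def real_psd_scale)

text \<open>The induction step of FitzGerald and Horn. The path \<open>C t\<close> joins the rank one matrix
$u u^T$ with the same last row and column as \<open>A\<close> to \<open>A\<close> itself. All its entries stay positive, and
the form of $f[C_t]$ has derivative the form of the Schur product of $f'[C_t]$ with \<open>B\<close>, where the last row and
column of \<open>B\<close> vanish. Hence it increases along the path, starting from a nonnegative value.\<close>

lemma preserves_psd_Suc:
  assumes deriv: "\<And>x. x > 0 \<Longrightarrow> (f has_real_derivative f' x) (at x)"
    and f': "preserves_psd N f'"
    and rank1: "\<And>u v. (\<And>i. i \<le> N \<Longrightarrow> u i > 0) \<Longrightarrow> 0 \<le> qform (Suc N) (\<lambda>i j. f (u i * u j)) v"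
  shows "preserves_psd (Suc N) f"
  unfolding preserves_psd_def
proof (intro allI impI)
  fix A
  assume "real_psd (Suc N) A \<and> (\<forall>i<Suc N. \<forall>j<Suc N. A i j > 0)"
  then have A: "real_psd (Suc N) A" and pos: "\<And>i j. i \<le> N \<Longrightarrow> j \<le> N \<Longrightarrow> A i j > 0"
    by auto
  define u where "u i = A i N / sqrt (A N N)" for i
  have u: "u i > 0" if "i \<le> N" for i using pos that by (simp add: u_def)
  define B where "B i j = A i j - A i N * A j N / A N N" for i j
  have uB: "u i * u j + B i j = A i j" for i j
    using pos[of N N] by (simp add: u_def B_def)
  have B: "real_psd (Suc N) B"
    unfolding B_def using schur_complement_psd[OF A] pos by simp
  have B0: "B i N = 0" "B N i = 0" if "i \<le> N" for i
    using pos[of N N] real_psdD(1)[OF A, of i N] that by (simp_all add: B_def)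
  define C where "C t i j = u i * u j + t * B i j" for t i j
  have Cpos: "C t i j > 0" if "i \<le> N" "j \<le> N" "0 \<le> t" "t \<le> 1" for t i j
  proof -
    have "C t i j = (1 - t) * (u i * u j) + t * A i j"
      by (simp add: C_def uB[symmetric] algebra_simps)
    moreover have "(1 - t) * (u i * u j) + t * A i j > 0"
      using that u pos by (cases "t = 0") (auto intro!: add_nonneg_pos mult_pos_pos simp: less_imp_le)
    ultimately show ?thesis by simp
  qed
  have Cpsd: "real_psd (Suc N) (C t)" if "0 \<le> t" for t
    unfolding C_def by (intro real_psd_add real_psd_scale real_psd_outer_product B that)
  have "0 \<le> qform (Suc N) (\<lambda>i j. f (A i j)) v" for v
  proof -
    define \<phi> where "\<phi> t = qform (Suc N) (\<lambda>i j. f (C t i j)) v" for t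
    have mono: "\<exists>y. (\<phi> has_real_derivative y) (at t) \<and> y \<ge> 0" if t: "0 \<le> t" "t \<le> 1" for t
    proof (intro exI conjI)
      have "((\<lambda>t. f (C t i j)) has_real_derivative f' (C t i j) * B i j) (at t)"
        if "i \<le> N" "j \<le> N" for i j
      proof (rule DERIV_chain2[where f = f])
        show "(f has_real_derivative f' (C t i j)) (at (C t i j))"
          using deriv Cpos that t by blast
        show "((\<lambda>t. C t i j) has_real_derivative B i j) (at t)"
          unfolding C_def by (auto intro!: derivative_eq_intros)
      qed
      then show "(\<phi> has_real_derivative qform (Suc N) (\<lambda>i j. f' (C t i j) * B i j) v) (at t)"
        unfolding \<phi>_def qform_def by (intro DERIV_sum DERIV_cmult) auto
      have "qform (Suc N) (\<lambda>i j. f' (C t i j) * B i j) v = qform N (\<lambda>i j. f' (C t i j) * B i j) v"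
        by (rule qform_vanishing_border) (simp_all add: B0)
      moreover have "real_psd N (\<lambda>i j. f' (C t i j) * B i j)"
        using f' Cpos t real_psd_leading_block[OF Cpsd[OF t(1)]] real_psd_leading_block[OF B]
        by (intro schur_product) (auto simp: preserves_psd_def)
      ultimately show "0 \<le> qform (Suc N) (\<lambda>i j. f' (C t i j) * B i j) v"
        by (simp add: real_psdD(2))
    qed
    have "\<phi> 0 \<le> \<phi> 1"
      by (rule DERIV_nonneg_imp_nondecreasing[OF zero_le_one mono])
    moreover have "\<phi> 0 \<ge> 0" unfolding \<phi>_def C_def using rank1[of u v] u by simp
    ultimately show ?thesis by (simp add: \<phi>_def C_def uB)
  qed
  then show "real_psd (Suc N) (\<lambda>i j. f (A i j))"
    using real_psdD(1)[OF A] by (simp add: real_psd_def)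
qed

lemma Nats_diff_one: "\<alpha> \<in> \<nat> \<Longrightarrow> \<alpha> \<noteq> 0 \<Longrightarrow> \<alpha> - 1 \<in> (\<nat> :: real set)"
proof (erule Nats_cases)
  fix k assume "\<alpha> \<noteq> 0" "\<alpha> = real k"
  then have "\<alpha> - 1 = real (k - 1)" by (cases k) auto
  then show "\<alpha> - 1 \<in> \<nat>" by simp
qed

text \<open>The derivative lowers both \<open>\<alpha>\<close> and the dimension by one, so the two alternatives for \<open>\<alpha>\<close> reproduce
themselves; the exponent $0$ is the exception, and there the derivative vanishes.\<close>

theorem preserves_psd_powr:
  assumes "\<alpha> \<in> \<nat> \<or> \<alpha> \<ge> real N - 2"
  shows "preserves_psd N (\<lambda>x. x powr \<alpha>)"
  using assms
proof (induction N arbitrary: \<alpha>)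
  case 0
  then show ?case by simp
next
  case (Suc N)
  show ?case
  proof (rule preserves_psd_Suc)
    show "((\<lambda>x. x powr \<alpha>) has_real_derivative \<alpha> * x powr (\<alpha> - 1)) (at x)" if "x > 0" for x
      using that by (auto intro!: derivative_eq_intros)
    show "preserves_psd N (\<lambda>x. \<alpha> * x powr (\<alpha> - 1))"
    proof (cases "N = 0 \<or> \<alpha> = 0")
      case True
      then show ?thesis by (auto simp: preserves_psd_def real_psd_def qform_def)
    next
      case False
      then have "\<alpha> \<ge> 0" using Suc.prems by (auto simp: Nats_def)
      moreover have "\<alpha> - 1 \<in> \<nat> \<or> \<alpha> - 1 \<ge> real N - 2"
        using Suc.prems False Nats_diff_one by auto
      ultimately show ?thesis using Suc.IH preserves_psd_scale by blast
    qed
    show "0 \<le> qform (Suc N) (\<lambda>i j. (u i * u j) powr \<alpha>) v"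
      if u: "\<And>i. i \<le> N \<Longrightarrow> u i > 0" for u v
    proof -
      have "qform (Suc N) (\<lambda>i j. (u i * u j) powr \<alpha>) v
          = qform (Suc N) (\<lambda>i j. u i powr \<alpha> * u j powr \<alpha>) v"
        by (rule qform_cong) (use u in \<open>auto simp: powr_mult less_imp_le\<close>)
      then show ?thesis by (simp add: qform_outer_product)
    qed
  qed
qed

section \<open>Sign patterns of real power sums\<close>

text \<open>Rolle's theorem between consecutive elements of \<open>V\<close>. The strict bounds by elements of \<open>V\<close> keep the new zeros
inside an interval that contains \<open>V\<close>.\<close>

lemma rolle_set:
  fixes f f' :: "real \<Rightarrow> real"
  assumes "finite V" "V \<subseteq> {0<..}" "\<And>x. x \<in> V \<Longrightarrow> f x = 0"
    and "\<And>x. x > 0 \<Longrightarrow> (f has_real_derivative f' x) (at x)"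
  shows "\<exists>W. finite W \<and> card W = card V - 1 \<and>
    (\<forall>x\<in>W. f' x = 0 \<and> (\<exists>u\<in>V. u < x) \<and> (\<exists>w\<in>V. x < w))"
  using assms(1-3)
proof (induction V rule: finite_linorder_max_induct)
  case empty
  then show ?case by (intro exI[of _ "{}"]) simp
next
  case (insert b A)
  show ?case
  proof (cases "A = {}")
    case True
    then show ?thesis by (intro exI[of _ "{}"]) simp
  next
    case False
    obtain W where W: "finite W" "card W = card A - 1"
      "\<And>x. x \<in> W \<Longrightarrow> f' x = 0 \<and> (\<exists>u\<in>A. u < x) \<and> (\<exists>w\<in>A. x < w)"
      using insert.IH insert.prems by auto
    define c where "c = Max A"
    have c: "c \<in> A" "\<And>x. x \<in> A \<Longrightarrow> x \<le> c"
      unfolding c_def using insert.hyps(1) False by auto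
    have "c < b" using insert.hyps(2) c(1) by blast
    moreover have "c > 0" using insert.prems(1) c(1) by auto
    ultimately obtain z where z: "c < z" "z < b" "f b - f c = (b - c) * f' z"
      using MVT2[of c b f f'] assms(4) by auto
    have "f' z = 0" using z(3) insert.prems(2) c(1) \<open>c < b\<close> by simp
    moreover have "z \<notin> W" using W(3) c(2) z(1) by fastforce
    moreover have "card (insert b A) = Suc (card A)" "card A > 0"
      using insert.hyps False by (auto simp: card_gt_0_iff)
    ultimately show ?thesis
      using W c(1) z(1,2) by (intro exI[of _ "insert z W"]) auto
  qed
qed

definition power_sum :: "nat \<Rightarrow> (nat \<Rightarrow> real) \<Rightarrow> (nat \<Rightarrow> real) \<Rightarrow> real \<Rightarrow> real" where
  "power_sum m e a x = (\<Sum>k\<le>m. a k * x powr e k)"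

text \<open>Rolle's theorem for $x^{-c} \sum_k a_k x^{e_k}$, whose derivative is again a power sum up to a
power of $x$. The choice $c = e_j$ removes the exponent $e_j$.\<close>

lemma power_sum_rolle:
  assumes "finite V" "V \<subseteq> {0<..}" "\<And>x. x \<in> V \<Longrightarrow> power_sum m e a x = 0"
  shows "\<exists>W. finite W \<and> W \<subseteq> {0<..} \<and> card W = card V - 1 \<and> (\<forall>x\<in>W. \<exists>w\<in>V. x < w) \<and>
    (\<forall>x\<in>W. power_sum m e (\<lambda>k. a k * (e k - c)) x = 0)"
proof -
  define f where "f x = (\<Sum>k\<le>m. a k * x powr (e k - c))" for x
  define f' where "f' x = (\<Sum>k\<le>m. a k * ((e k - c) * x powr (e k - c - 1)))" for x
  have f: "f x = x powr (- c) * power_sum m e a x" for x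
    by (simp add: f_def power_sum_def sum_distrib_left powr_diff powr_minus field_simps)
  have f': "power_sum m e (\<lambda>k. a k * (e k - c)) x = x powr (c + 1) * f' x" if "x > 0" for x
    using that by (simp add: f'_def power_sum_def sum_distrib_left mult_ac flip: powr_add)
  have "(f has_real_derivative f' x) (at x)" if "x > 0" for x
    unfolding f_def f'_def using that by (auto intro!: derivative_eq_intros DERIV_sum)
  from rolle_set[OF assms(1,2) _ this] obtain W where W: "finite W" "card W = card V - 1"
    "\<And>x. x \<in> W \<Longrightarrow> f' x = 0 \<and> (\<exists>u\<in>V. u < x) \<and> (\<exists>w\<in>V. x < w)"
    using assms(3) by (auto simp: f)
  have pos: "x > 0" if "x \<in> W" for x using W(3)[OF that] assms(2) by force
  show ?thesis
    using W pos f' by (intro exI[of _ W]) auto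
qed

lemma power_sum_Suc: "power_sum (Suc m) e a x = power_sum m e a x + a (Suc m) * x powr e (Suc m)"
  by (simp add: power_sum_def)

lemma power_sum_Suc_shift:
  "power_sum (Suc m) e a x = a 0 * x powr e 0 + power_sum m (e \<circ> Suc) (a \<circ> Suc) x"
  unfolding power_sum_def by (subst sum.atMost_Suc_shift) simp

lemma power_sum_cong:
  "(\<And>k. k \<le> m \<Longrightarrow> a k = b k) \<Longrightarrow> (\<And>k. k \<le> m \<Longrightarrow> e k = e' k) \<Longrightarrow>
     power_sum m e a x = power_sum m e' b x"
  by (simp add: power_sum_def)

lemma power_sum_zero: "(\<And>k. k \<le> m \<Longrightarrow> a k = 0) \<Longrightarrow> power_sum m e a x = 0"
  by (simp add: power_sum_def)

lemma power_sum_scale: "power_sum m e (\<lambda>k. t * a k) x = t * power_sum m e a x"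
  by (simp add: power_sum_def sum_distrib_left mult_ac)

lemma power_sum_diff:
  "power_sum m e (\<lambda>k. a k - b k) x = power_sum m e a x - power_sum m e b x"
  by (simp add: power_sum_def left_diff_distrib sum_subtractf)

lemma strict_mono_on_shift:
  "strict_mono_on {..Suc m} (e :: nat \<Rightarrow> real) \<Longrightarrow> strict_mono_on {..m} (e \<circ> Suc)"
  by (auto simp: strict_mono_on_def)

text \<open>A sharp form of Descartes' rule of signs. Rolle's theorem removes either the smallest or the largest exponent at
the cost of one zero. Each removal multiplies the remaining coefficients by factors of one
sign, so the sign changes found by induction carry over; with at least three exponents each pair of
consecutive ones survives one of the two removals.\<close>

theorem alternating_coeffs:
  assumes "strict_mono_on {..m} e" "finite V" "V \<subseteq> {0<..}" "card V = m"
    and "\<And>x. x \<in> V \<Longrightarrow> power_sum m e a x = 0"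
  shows "(\<forall>k\<le>m. a k = 0) \<or> (\<forall>k<m. a k * a (Suc k) < 0)"
  using assms
proof (induction m arbitrary: e a V)
  case 0
  then show ?case by simp
next
  case (Suc m)
  have less: "e i < e j" if "i < j" "j \<le> Suc m" for i j
    using Suc.prems(1) that by (auto simp: strict_mono_on_def)
  obtain x where x: "x \<in> V" "x > 0" "power_sum (Suc m) e a x = 0"
    using Suc.prems by (metis card_eq_0_iff ex_in_conv greaterThan_iff nat.simps(3) subsetD)
  show ?case
  proof (cases "m = 0")
    case True
    then have eq: "a 1 * x powr e 1 = - (a 0 * x powr e 0)"
      using x(3) by (simp add: power_sum_def)
    show ?thesis
    proof (cases "a 0 = 0")
      case False
      have "a 0 * a 1 * x powr e 1 = - ((a 0)\<^sup>2 * x powr e 0)"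
        using eq by (simp add: power2_eq_square mult.assoc)
      also have "\<dots> < 0" using False x(2) by simp
      finally have "a 0 * a 1 < 0" using x(2) by (simp add: mult_less_0_iff)
      then show ?thesis using True by simp
    qed (use eq x(2) True in \<open>auto simp: le_Suc_eq\<close>)
  next
    case False
    then have "m > 0" by simp
    define b where "b k = a k * (e k - e 0)" for k
    define c where "c k = a k * (e k - e (Suc m))" for k
    obtain W where W: "finite W" "W \<subseteq> {0<..}" "card W = m"
      "\<And>x. x \<in> W \<Longrightarrow> power_sum (Suc m) e b x = 0"
      using power_sum_rolle[OF Suc.prems(2,3,5), where c = "e 0"] Suc.prems(4)
      unfolding b_def by auto
    have first: "(\<forall>k\<le>m. b (Suc k) = 0) \<or> (\<forall>k<m. b (Suc k) * b (Suc (Suc k)) < 0)"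
    proof -
      have "b 0 = 0" by (simp add: b_def)
      then have "power_sum m (e \<circ> Suc) (b \<circ> Suc) x = 0" if "x \<in> W" for x
        using W(4)[OF that] by (simp add: power_sum_Suc_shift)
      from Suc.IH[OF strict_mono_on_shift[OF Suc.prems(1)] W(1-3) this]
      show ?thesis by simp
    qed
    obtain W where W: "finite W" "W \<subseteq> {0<..}" "card W = m"
      "\<And>x. x \<in> W \<Longrightarrow> power_sum (Suc m) e c x = 0"
      using power_sum_rolle[OF Suc.prems(2,3,5), where c = "e (Suc m)"] Suc.prems(4)
      unfolding c_def by auto
    have last: "(\<forall>k\<le>m. c k = 0) \<or> (\<forall>k<m. c k * c (Suc k) < 0)"
    proof (rule Suc.IH[OF _ W(1-3)])
      show "strict_mono_on {..m} e" using less by (auto simp: strict_mono_on_def)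
      show "power_sum m e c x = 0" if "x \<in> W" for x
        using W(4)[OF that] by (simp add: power_sum_Suc c_def)
    qed
    consider "\<forall>k\<le>m. b (Suc k) = 0" | "\<forall>k\<le>m. c k = 0"
      | "\<forall>k<m. b (Suc k) * b (Suc (Suc k)) < 0" "\<forall>k<m. c k * c (Suc k) < 0"
      using first last by blast
    then show ?thesis
    proof cases
      case 1
      then have z: "a (Suc k) = 0" if "k \<le> m" for k
        using that less[of 0 "Suc k"] by (auto simp: b_def)
      then have "power_sum m (e \<circ> Suc) (a \<circ> Suc) x = 0" by (intro power_sum_zero) simp
      then have "a 0 = 0" using x by (simp add: power_sum_Suc_shift)
      then have "\<forall>k\<le>Suc m. a k = 0" using z by (metis Suc_le_mono old.nat.exhaust)
      then show ?thesis ..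
    next
      case 2
      then have z: "a k = 0" if "k \<le> m" for k
        using that less[of k "Suc m"] by (auto simp: c_def)
      then have "power_sum m e a x = 0" by (intro power_sum_zero) simp
      then have "a (Suc m) = 0" using x by (simp add: power_sum_Suc)
      then show ?thesis using z by (auto simp: le_Suc_eq)
    next
      case 3
      have "a k * a (Suc k) < 0" if "k < Suc m" for k
      proof (cases k)
        case 0
        have "c 0 * c (Suc 0) = a 0 * a 1 * ((e 0 - e (Suc m)) * (e 1 - e (Suc m)))"
          by (simp add: c_def)
        moreover have "(e 0 - e (Suc m)) * (e 1 - e (Suc m)) > 0"
          using less[of 0 "Suc m"] less[of 1 "Suc m"] \<open>m > 0\<close> by (intro mult_neg_neg) auto
        moreover have "c 0 * c (Suc 0) < 0" using 3 \<open>m > 0\<close> by blast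
        ultimately have "a 0 * a 1 < 0" by (metis mult_less_cancel_right_pos mult_zero_left)
        then show ?thesis using 0 by simp
      next
        case (Suc j)
        have "b k * b (Suc k) = a k * a (Suc k) * ((e k - e 0) * (e (Suc k) - e 0))"
          by (simp add: b_def)
        moreover have "(e k - e 0) * (e (Suc k) - e 0) > 0"
          using less[of 0 k] less[of 0 "Suc k"] that Suc by (intro mult_pos_pos) auto
        moreover have "b k * b (Suc k) < 0" using 3 Suc that by auto
        ultimately show ?thesis by (metis mult_less_cancel_right_pos mult_zero_left)
      qed
      then show ?thesis by blast
    qed
  qed
qed

text \<open>Append one more exponent with coefficient $0$: the extended coefficients do not alternate strictly, so
they all vanish.\<close>

lemma power_sum_too_many_zeros:
  assumes "strict_mono_on {..m} e" "finite V" "V \<subseteq> {0<..}" "card V = Suc m"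
    and "\<And>x. x \<in> V \<Longrightarrow> power_sum m e a x = 0" and "k \<le> m"
  shows "a k = 0"
proof -
  let ?e = "e(Suc m := e m + 1)" and ?a = "a(Suc m := 0)"
  have "e i \<le> e m" if "i \<le> m" for i
    using assms(1) that by (cases "i = m") (auto simp: strict_mono_on_def less_imp_le)
  then have "strict_mono_on {..Suc m} ?e"
    using assms(1) by (fastforce simp: strict_mono_on_def le_Suc_eq)
  moreover have "power_sum (Suc m) ?e ?a x = 0" if "x \<in> V" for x
    using assms(5)[OF that] power_sum_cong[of m ?a a ?e e x] by (simp add: power_sum_Suc)
  ultimately have "(\<forall>k\<le>Suc m. ?a k = 0) \<or> (\<forall>k<Suc m. ?a k * ?a (Suc k) < 0)"
    using alternating_coeffs[OF _ assms(2-4), of ?e ?a] by blast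
  moreover have "\<not> ?a m * ?a (Suc m) < 0" by simp
  ultimately have "\<forall>k\<le>Suc m. ?a k = 0" by blast
  then show ?thesis using assms(6) by (auto dest!: spec[of _ k])
qed

text \<open>An elimination in the style of divided differences. A sum \<open>P\<close> without the last exponent and a sum \<open>Q\<close>
without the first one, both with the first \<open>m\<close> zeros, combine to $Q(x) P - P(x) Q$, which vanishes
at the additional point $x$ too. The coefficient at the first exponent is a multiple of $Q(x)$, which
is nonzero as \<open>Q\<close> has no room for a further zero.\<close>

lemma power_sum_with_zeros:
  assumes "strict_mono_on {..m} e" "finite V" "V \<subseteq> {0<..}" "card V = m"
  shows "\<exists>a. a 0 \<noteq> 0 \<and> (\<forall>x\<in>V. power_sum m e a x = 0)"
  using assms
proof (induction m arbitrary: e V)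
  case 0
  then show ?case by (intro exI[of _ "\<lambda>_. 1"]) simp
next
  case (Suc m)
  obtain x V' where V: "V = insert x V'" "x \<notin> V'" "card V' = m"
    using Suc.prems(4) by (metis card_Suc_eq)
  have V': "finite V'" "V' \<subseteq> {0<..}" using Suc.prems V by auto
  have mono: "strict_mono_on {..m} e" using Suc.prems(1) by (auto simp: strict_mono_on_def)
  obtain a where a: "a 0 \<noteq> 0" "\<And>y. y \<in> V' \<Longrightarrow> power_sum m e a y = 0"
    using Suc.IH[OF mono V' V(3)] by blast
  obtain b where b: "b 0 \<noteq> 0" "\<And>y. y \<in> V' \<Longrightarrow> power_sum m (e \<circ> Suc) b y = 0"
    using Suc.IH[OF strict_mono_on_shift[OF Suc.prems(1)] V' V(3)] by blast
  define P where "P = power_sum m e a"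
  define Q where "Q = power_sum m (e \<circ> Suc) b"
  have "Q x \<noteq> 0"
  proof
    assume "Q x = 0"
    then have "b 0 = 0"
      using b(2) V(1)
      by (intro power_sum_too_many_zeros[OF strict_mono_on_shift[OF Suc.prems(1)] Suc.prems(2-4), of b 0])
        (auto simp: Q_def)
    then show False using b(1) by simp
  qed
  define c where "c = (\<lambda>k. Q x * (a(Suc m := 0)) k - P x * case_nat 0 b k)"
  have "power_sum (Suc m) e (a(Suc m := 0)) y = P y" for y
    using power_sum_cong[of m "a(Suc m := 0)" a e e y] by (simp add: power_sum_Suc P_def)
  moreover have "power_sum (Suc m) e (case_nat 0 b) y = Q y" for y
  proof -
    have "case_nat 0 b \<circ> Suc = b" by (simp add: fun_eq_iff)
    then show ?thesis by (simp add: power_sum_Suc_shift Q_def)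
  qed
  ultimately have "power_sum (Suc m) e c y = Q x * P y - P x * Q y" for y
    by (simp only: c_def power_sum_diff power_sum_scale)
  then have "\<forall>y\<in>V. power_sum (Suc m) e c y = 0"
    using a(2) b(2) V(1) by (auto simp: P_def Q_def)
  moreover have "c 0 \<noteq> 0" using a(1) \<open>Q x \<noteq> 0\<close> by (simp add: c_def)
  ultimately show ?case by blast
qed

lemma alternating_sign:
  fixes a :: "nat \<Rightarrow> real"
  assumes "\<And>k. k < m \<Longrightarrow> a k * a (Suc k) < 0" "a m \<noteq> 0" "k \<le> m"
  shows "(- 1) ^ (m - k) * a k * a m > 0"
  using assms(3)
proof (induction "m - k" arbitrary: k)
  case 0
  then show ?case using assms(2) by (auto simp: zero_less_mult_iff linorder_neq_iff)
next
  case (Suc d)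
  then have k: "k < m" and *: "m - k = Suc (m - Suc k)" by auto
  have IH: "(- 1) ^ (m - Suc k) * a (Suc k) * a m > 0"
    using Suc.hyps(1)[of "Suc k"] Suc.hyps(2) k by simp
  have "0 < ((- 1) ^ (m - Suc k) * a (Suc k) * a m) * - (a k * a (Suc k))"
    by (rule mult_pos_pos[OF IH]) (use assms(1)[OF k] in simp)
  also have "\<dots> = (a (Suc k))\<^sup>2 * ((- 1) ^ (m - k) * a k * a m)"
    by (simp add: * power2_eq_square)
  finally show ?case by (simp add: zero_less_mult_iff)
qed

lemma alternating_nonzero:
  assumes "strict_mono_on {..m} e" "finite V" "V \<subseteq> {0<..}" "card V = m"
    and "\<And>x. x \<in> V \<Longrightarrow> power_sum m e a x = 0" and "j \<le> m" "a j \<noteq> 0"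
  shows "\<And>k. k < m \<Longrightarrow> a k * a (Suc k) < 0" "\<And>k. k \<le> m \<Longrightarrow> a k \<noteq> 0"
proof -
  show *: "a k * a (Suc k) < 0" if "k < m" for k
    using alternating_coeffs[OF assms(1-5)] assms(6,7) that by blast
  show "a k \<noteq> 0" if "k \<le> m" for k
  proof (cases "k < m")
    case True
    then show ?thesis using * by fastforce
  next
    case False
    then have "k = m" using that by simp
    then show ?thesis using * assms(6,7) by (cases m) fastforce+
  qed
qed

lemma normalized_power_sum_with_zeros:
  assumes "strict_mono_on {..m} e" "finite V" "V \<subseteq> {0<..}" "card V = m" "p \<le> m"
  shows "\<exists>a. a p = 1 \<and> (\<forall>x\<in>V. power_sum m e a x = 0)"
proof -
  obtain a where a: "a 0 \<noteq> 0" "\<And>x. x \<in> V \<Longrightarrow> power_sum m e a x = 0"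
    using power_sum_with_zeros[OF assms(1-4)] by blast
  have "a p \<noteq> 0" using alternating_nonzero(2)[OF assms(1-4) a(2) _ a(1)] assms(5) by simp
  then show ?thesis
    using a(2) by (intro exI[of _ "\<lambda>k. (1 / a p) * a k"]) (simp only: power_sum_scale, simp)
qed

section \<open>Interpolation of a power with bounded coefficients\<close>

text \<open>Splitting off an inner index while keeping the others consecutive: this is used to read a power sum without
its term \<open>p\<close> as a power sum with one exponent less.\<close>

lemma sum_atMost_Suc_skip:
  fixes g :: "nat \<Rightarrow> real"
  assumes "p \<le> Suc m"
  shows "(\<Sum>k\<le>Suc m. g k) = g p + (\<Sum>j\<le>m. g (if j < p then j else Suc j))"
proof -
  have "(\<Sum>k\<in>{..Suc m} - {p}. g k) = (\<Sum>j\<le>m. g (if j < p then j else Suc j))"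
    by (rule sum.reindex_bij_witness[where i = "\<lambda>j. if j < p then j else Suc j"
          and j = "\<lambda>k. if k < p then k else k - 1"]) (use assms in auto)
  then show ?thesis using sum.remove[of "{..Suc m}" p g] assms by (simp del: sum.atMost_Suc)
qed

text \<open>Both sums have coefficient $1$ at the exponent \<open>p\<close>, so that exponent is absent from their difference \<open>d\<close>, which
still has the maximal number of zeros and therefore alternates, too. At the top exponent \<open>d\<close> has
the sign opposite to \<open>a\<close>. Going down, both alternate, but \<open>d\<close> skips the exponent \<open>p\<close>; so
below \<open>p\<close> the signs of \<open>d\<close> and \<open>a\<close> agree, and $b = a + d$ is larger in absolute value.\<close>

lemma coeff_le_of_truncation:
  assumes mono: "strict_mono_on {..Suc m} e" and p: "p \<le> m"
    and V: "finite V" "V \<subseteq> {0<..}" "card V = Suc m" and x: "x \<in> V"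
    and a: "a p = 1" "\<And>y. y \<in> V \<Longrightarrow> power_sum (Suc m) e a y = 0"
    and b: "b p = 1" "\<And>y. y \<in> V - {x} \<Longrightarrow> power_sum m e b y = 0"
    and k: "k < p"
  shows "\<bar>a k\<bar> \<le> \<bar>b k\<bar>"
proof -
  define b' where "b' = b(Suc m := 0)"
  define d where "d = (\<lambda>k. b' k - a k)"
  define skip where "skip j = (if j < p then j else Suc j)" for j
  have a_alt: "a i * a (Suc i) < 0" if "i < Suc m" for i
    using alternating_nonzero(1)[OF mono V a(2), of p] a(1) p that by simp
  have a_nz: "a (Suc m) \<noteq> 0"
    using alternating_nonzero(2)[OF mono V a(2), of p] a(1) p by simp
  have b_ext: "power_sum (Suc m) e b' y = power_sum m e b y" for y
    using power_sum_cong[of m b' b e e y] by (simp add: power_sum_Suc b'_def)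
  have "power_sum (Suc m) e d y = 0" if "y \<in> V - {x}" for y
    using a(2)[of y] b(2)[OF that] that by (simp add: d_def power_sum_diff b_ext)
  moreover have "d p = 0" using a(1) b(1) p by (simp add: d_def b'_def)
  ultimately have d: "power_sum m (e \<circ> skip) (d \<circ> skip) y = 0" if "y \<in> V - {x}" for y
    using that sum_atMost_Suc_skip[of p m "\<lambda>k. d k * y powr e k"] p
    by (simp add: power_sum_def skip_def)
  have mono_skip: "strict_mono_on {..m} (e \<circ> skip)"
    using mono by (auto simp: strict_mono_on_def skip_def)
  have W: "finite (V - {x})" "V - {x} \<subseteq> {0<..}" "card (V - {x}) = m"
    using V x by auto
  have dm: "(d \<circ> skip) m = - a (Suc m)" using p by (simp add: d_def b'_def skip_def)
  have d_alt: "(d \<circ> skip) i * (d \<circ> skip) (Suc i) < 0" if "i < m" for i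
    using alternating_nonzero(1)[OF mono_skip W d order_refl] dm a_nz that by simp
  have "0 < (- 1) ^ (m - k) * (d \<circ> skip) k * (d \<circ> skip) m"
    using alternating_sign[where a = "d \<circ> skip" and k = k and m = m, OF d_alt] dm a_nz k p by simp
  then have 1: "0 < (- 1) ^ (m - k) * d k * - a (Suc m)"
    using dm k by (simp add: skip_def)
  have "0 < (- 1) ^ (Suc m - k) * a k * a (Suc m)"
    using alternating_sign[where a = a and k = k, OF a_alt a_nz] k p by simp
  then have 2: "0 < (- 1) ^ (m - k) * a k * - a (Suc m)"
    using k p by (simp add: Suc_diff_le)
  define s where "s = (- 1) ^ (m - k) * a (Suc m)"
  have "s * d k < 0" "s * a k < 0" using 1 2 by (simp_all add: s_def mult_ac)
  then have "d k < 0 \<and> a k < 0 \<or> 0 < d k \<and> 0 < a k" by (auto simp: mult_less_0_iff)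
  moreover have "b k = a k + d k" using k p by (simp add: d_def b'_def)
  ultimately show ?thesis by linarith
qed

text \<open>Removing the lowest exponent by Rolle's theorem keeps the zeros in $(0,1]$ and rescales the other
coefficients by fixed factors, so these are bounded by induction. The lowest coefficient is then recovered from
any zero $x$: since $x \le 1$, the lowest power is the largest one.\<close>

lemma coeffs_bounded_unit_interval:
  assumes "strict_mono_on {..p} e"
  shows "\<exists>K. \<forall>a V. finite V \<and> V \<subseteq> {0<..1} \<and> card V = p \<and> a p = 1 \<and>
    (\<forall>x\<in>V. power_sum p e a x = 0) \<longrightarrow> (\<forall>k\<le>p. \<bar>a k\<bar> \<le> K)"
  using assms
proof (induction p arbitrary: e)
  case 0
  then show ?case by (intro exI[of _ 1]) auto
next
  case (Suc p)
  have less: "e 0 < e (Suc k)" if "k \<le> p" for k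
    using Suc.prems that by (auto simp: strict_mono_on_def)
  obtain K where K: "\<And>a V k. finite V \<Longrightarrow> V \<subseteq> {0<..1} \<Longrightarrow> card V = p \<Longrightarrow> a p = 1 \<Longrightarrow>
      (\<And>x. x \<in> V \<Longrightarrow> power_sum p (e \<circ> Suc) a x = 0) \<Longrightarrow> k \<le> p \<Longrightarrow> \<bar>a k\<bar> \<le> K"
    using Suc.IH[OF strict_mono_on_shift[OF Suc.prems]] by metis
  define L where "L k = K * (e (Suc p) - e 0) / (e (Suc k) - e 0)" for k
  show ?case
  proof (intro exI[of _ "\<Sum>k\<le>p. L k"] allI impI)
    fix a V k
    assume "finite V \<and> V \<subseteq> {0<..1} \<and> card V = Suc p \<and> a (Suc p) = 1 \<and>
      (\<forall>x\<in>V. power_sum (Suc p) e a x = 0)" and k: "k \<le> Suc p"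
    then have V: "finite V" "V \<subseteq> {0<..1}" "card V = Suc p" and a: "a (Suc p) = 1"
      and zeros: "\<And>x. x \<in> V \<Longrightarrow> power_sum (Suc p) e a x = 0" by auto
    have Vpos: "V \<subseteq> {0<..}" using V(2) by auto
    \<comment> \<open>normalised so that the top coefficient is again 1\<close>
    define b where "b = (\<lambda>k. 1 / (e (Suc p) - e 0) * (a k * (e k - e 0)))"
    obtain W where W: "finite W" "W \<subseteq> {0<..}" "card W = p" "\<And>x. x \<in> W \<Longrightarrow> \<exists>w\<in>V. x < w"
      "\<And>x. x \<in> W \<Longrightarrow> power_sum (Suc p) e (\<lambda>k. a k * (e k - e 0)) x = 0"
      using power_sum_rolle[OF V(1) Vpos zeros, of "e 0"] V(3) by auto
    have W1: "W \<subseteq> {0<..1}" using W(2,4) V(2) by fastforce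
    have b0: "b 0 = 0" by (simp add: b_def)
    have bW: "power_sum p (e \<circ> Suc) (b \<circ> Suc) x = 0" if "x \<in> W" for x
    proof -
      have "power_sum (Suc p) e b x = 0"
        unfolding b_def power_sum_scale using W(5)[OF that] by simp
      then show ?thesis using b0 by (simp add: power_sum_Suc_shift)
    qed
    have aL: "\<bar>a (Suc k)\<bar> \<le> L k" if "k \<le> p" for k
    proof -
      have "(b \<circ> Suc) p = 1" using less[of p] a by (simp add: b_def)
      then have "\<bar>(b \<circ> Suc) k\<bar> \<le> K" using K[OF W(1) W1 W(3) _ bW that] by blast
      moreover have "\<bar>(b \<circ> Suc) k\<bar> = \<bar>a (Suc k)\<bar> * (e (Suc k) - e 0) / (e (Suc p) - e 0)"
        using less[OF that] less[of p] by (simp add: b_def abs_mult)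
      ultimately show ?thesis
        using less[OF that] less[of p] by (simp add: L_def pos_le_divide_eq pos_divide_le_eq)
    qed
    have a_sum: "(\<Sum>k\<le>p. \<bar>a (Suc k)\<bar>) \<le> (\<Sum>k\<le>p. L k)" using aL by (intro sum_mono) simp
    show "\<bar>a k\<bar> \<le> (\<Sum>k\<le>p. L k)"
    proof (cases k)
      case (Suc j)
      have "\<bar>a (Suc j)\<bar> \<le> (\<Sum>k\<le>p. \<bar>a (Suc k)\<bar>)"
        using k Suc by (intro member_le_sum[of j "{..p}" "\<lambda>k. \<bar>a (Suc k)\<bar>"]) auto
      then show ?thesis using a_sum Suc by simp
    next
      case 0
      obtain x where x: "x \<in> V" using V(3) by fastforce
      then have x01: "0 < x" "x \<le> 1" using V(2) by auto
      have "a 0 * x powr e 0 = - (\<Sum>k\<le>p. a (Suc k) * x powr e (Suc k))"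
        using zeros[OF x] unfolding power_sum_Suc_shift by (simp add: power_sum_def)
      then have "\<bar>a 0\<bar> * x powr e 0 = \<bar>\<Sum>k\<le>p. a (Suc k) * x powr e (Suc k)\<bar>"
        by (metis abs_minus_cancel abs_mult abs_of_nonneg powr_ge_zero)
      also have "\<dots> \<le> (\<Sum>k\<le>p. \<bar>a (Suc k) * x powr e (Suc k)\<bar>)" by (rule sum_abs)
      also have "\<dots> \<le> (\<Sum>k\<le>p. \<bar>a (Suc k)\<bar> * x powr e 0)"
      proof (rule sum_mono)
        fix k assume "k \<in> {..p}"
        then have "x powr e (Suc k) \<le> x powr e 0"
          using less[of k] x01 by (intro powr_mono') auto
        then show "\<bar>a (Suc k) * x powr e (Suc k)\<bar> \<le> \<bar>a (Suc k)\<bar> * x powr e 0"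
          by (simp add: abs_mult mult_left_mono)
      qed
      also have "\<dots> = (\<Sum>k\<le>p. \<bar>a (Suc k)\<bar>) * x powr e 0" by (simp add: sum_distrib_right)
      finally have "\<bar>a 0\<bar> \<le> (\<Sum>k\<le>p. \<bar>a (Suc k)\<bar>)" using x01 by simp
      then show ?thesis using a_sum 0 by simp
    qed
  qed
qed

text \<open>Induction on the number of exponents above the one with coefficient $1$: \<open>coeff_le_of_truncation\<close> deletes the
top exponent together with a zero from \<open>B\<close>, so the bound for \<open>q = 0\<close> persists.\<close>

lemma lower_coeffs_bounded:
  assumes "strict_mono_on {..p + q} e"
  shows "\<exists>K. \<forall>a A B. finite A \<and> A \<subseteq> {0<..1} \<and> card A = p \<and>
    finite B \<and> B \<subseteq> {0<..} \<and> card B = q \<and> A \<inter> B = {} \<and>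
    a p = 1 \<and> (\<forall>x\<in>A \<union> B. power_sum (p + q) e a x = 0) \<longrightarrow> (\<forall>k<p. \<bar>a k\<bar> \<le> K)"
  using assms
proof (induction q)
  case 0
  then have "strict_mono_on {..p} e" by simp
  then obtain K where K: "\<forall>a V. finite V \<and> V \<subseteq> {0<..1} \<and> card V = p \<and> a p = 1 \<and>
    (\<forall>x\<in>V. power_sum p e a x = 0) \<longrightarrow> (\<forall>k\<le>p. \<bar>a k\<bar> \<le> K)"
    using coeffs_bounded_unit_interval by blast
  show ?case
  proof (intro exI[of _ K] allI impI)
    fix a A B k
    assume asm: "finite A \<and> A \<subseteq> {0<..1} \<and> card A = p \<and>
      finite B \<and> B \<subseteq> {0<..} \<and> card B = 0 \<and> A \<inter> B = {} \<and>
      a p = 1 \<and> (\<forall>x\<in>A \<union> B. power_sum (p + 0) e a x = 0)" and "k < p"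
    then show "\<bar>a k\<bar> \<le> K" using K[rule_format, of A a k] by simp
  qed
next
  case (Suc q)
  have mono: "strict_mono_on {..p + q} e" "strict_mono_on {..Suc (p + q)} e"
    using Suc.prems by (auto simp: strict_mono_on_def)
  obtain K where K: "\<And>a A B k. finite A \<Longrightarrow> A \<subseteq> {0<..1} \<Longrightarrow> card A = p \<Longrightarrow>
    finite B \<Longrightarrow> B \<subseteq> {0<..} \<Longrightarrow> card B = q \<Longrightarrow> A \<inter> B = {} \<Longrightarrow>
    a p = 1 \<Longrightarrow> (\<And>x. x \<in> A \<union> B \<Longrightarrow> power_sum (p + q) e a x = 0) \<Longrightarrow> k < p \<Longrightarrow> \<bar>a k\<bar> \<le> K"
    using Suc.IH[OF mono(1)] by metis
  show ?case
  proof (intro exI[of _ K] allI impI)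
    fix a A B k
    assume asm: "finite A \<and> A \<subseteq> {0<..1} \<and> card A = p \<and>
      finite B \<and> B \<subseteq> {0<..} \<and> card B = Suc q \<and> A \<inter> B = {} \<and>
      a p = 1 \<and> (\<forall>x\<in>A \<union> B. power_sum (p + Suc q) e a x = 0)" and k: "k < p"
    then obtain x B' where x: "B = insert x B'" "x \<notin> B'" "card B' = q"
      by (metis card_Suc_eq)
    then have B': "finite B'" "B' \<subseteq> {0<..}" "A \<inter> B' = {}" using asm by auto
    have A: "finite A" "A \<subseteq> {0<..1}" "card A = p" "A \<subseteq> {0<..}" using asm by auto
    have V: "finite (A \<union> B')" "A \<union> B' \<subseteq> {0<..}" "card (A \<union> B') = p + q"
      using A B' x(3) by (auto simp: card_Un_disjoint)
    then obtain b where b: "b p = 1" "\<And>y. y \<in> A \<union> B' \<Longrightarrow> power_sum (p + q) e b y = 0"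
      using normalized_power_sum_with_zeros[OF mono(1) V, of p] by auto
    have "\<bar>a k\<bar> \<le> \<bar>b k\<bar>"
    proof (rule coeff_le_of_truncation[OF mono(2), where V = "A \<union> B" and x = x and p = p])
      show "card (A \<union> B) = Suc (p + q)" using asm by (simp add: card_Un_disjoint)
      show "power_sum (p + q) e b y = 0" if "y \<in> A \<union> B - {x}" for y
        using b(2) that x by blast
    qed (use asm A b(1) k x in auto)
    also have "\<dots> \<le> K" using K[OF A(1-3) B'(1,2) x(3) B'(3)] b k by blast
    finally show "\<bar>a k\<bar> \<le> K" .
  qed
qed

lemma power_sum_reflect:
  assumes "x > 0"
  shows "power_sum m (\<lambda>k. - e (m - k)) (\<lambda>k. a (m - k)) (inverse x) = power_sum m e a x"
proof -
  have "inverse x powr (- e j) = x powr e j" for j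
    using assms by (simp add: powr_minus inverse_powr)
  then show ?thesis
    unfolding power_sum_def
    by (intro sum.reindex_bij_witness[where i = "\<lambda>k. m - k" and j = "\<lambda>k. m - k"]) auto
qed

text \<open>The substitution $x \mapsto 1/x$ exchanges the exponents below and above the normalised one as well as the zeros
below and above $1$, which yields the bound for the coefficients with index beyond \<open>p\<close>.\<close>

lemma coeffs_bounded:
  assumes mono: "strict_mono_on {..p + q} e"
  shows "\<exists>K. \<forall>a A B. finite A \<and> A \<subseteq> {0<..1} \<and> card A = p \<and>
    finite B \<and> B \<subseteq> {1<..} \<and> card B = q \<and>
    a p = 1 \<and> (\<forall>x\<in>A \<union> B. power_sum (p + q) e a x = 0) \<longrightarrow> (\<forall>k\<le>p + q. \<bar>a k\<bar> \<le> K)"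
proof -
  obtain K where K: "\<And>a A B k. finite A \<Longrightarrow> A \<subseteq> {0<..1} \<Longrightarrow> card A = p \<Longrightarrow>
    finite B \<Longrightarrow> B \<subseteq> {0<..} \<Longrightarrow> card B = q \<Longrightarrow> A \<inter> B = {} \<Longrightarrow>
    a p = 1 \<Longrightarrow> (\<And>x. x \<in> A \<union> B \<Longrightarrow> power_sum (p + q) e a x = 0) \<Longrightarrow> k < p \<Longrightarrow> \<bar>a k\<bar> \<le> K"
    using lower_coeffs_bounded[OF mono] by metis
  let ?e = "\<lambda>k. - e (p + q - k)"
  have "strict_mono_on {..q + p} ?e"
    using mono by (auto simp: strict_mono_on_def)
  then obtain L where L: "\<And>a A B k. finite A \<Longrightarrow> A \<subseteq> {0<..1} \<Longrightarrow> card A = q \<Longrightarrow>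
    finite B \<Longrightarrow> B \<subseteq> {0<..} \<Longrightarrow> card B = p \<Longrightarrow> A \<inter> B = {} \<Longrightarrow>
    a q = 1 \<Longrightarrow> (\<And>x. x \<in> A \<union> B \<Longrightarrow> power_sum (q + p) ?e a x = 0) \<Longrightarrow> k < q \<Longrightarrow> \<bar>a k\<bar> \<le> L"
    using lower_coeffs_bounded[of q p ?e] by metis
  show ?thesis
  proof (intro exI[of _ "max 1 (max K L)"] allI impI)
    fix a A B k
    assume asm: "finite A \<and> A \<subseteq> {0<..1} \<and> card A = p \<and>
      finite B \<and> B \<subseteq> {1<..} \<and> card B = q \<and>
      a p = 1 \<and> (\<forall>x\<in>A \<union> B. power_sum (p + q) e a x = 0)" and k: "k \<le> p + q"
    have pos: "x > 0" if "x \<in> A \<union> B" for x using asm that by force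
    have disj: "A \<inter> B = {}" using asm by fastforce
    consider "k < p" | "k = p" | "p < k" by linarith
    then show "\<bar>a k\<bar> \<le> max 1 (max K L)"
    proof cases
      case 1
      have "\<bar>a k\<bar> \<le> K"
        using asm disj pos 1 by (intro K[of A B]) auto
      then show ?thesis by simp
    next
      case 2
      then show ?thesis using asm by simp
    next
      case 3
      have "\<bar>a (p + q - (p + q - k))\<bar> \<le> L"
      proof (rule L[where a = "\<lambda>k. a (p + q - k)" and A = "inverse ` B" and B = "inverse ` A"])
        show "finite (inverse ` B)" "finite (inverse ` A)" using asm by auto
        show "inverse ` B \<subseteq> {0<..1}" using asm by (force simp: inverse_le_1_iff)
        show "inverse ` A \<subseteq> {0<..}" using pos by auto
        show "card (inverse ` B) = q" "card (inverse ` A) = p"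
          using asm by (auto simp: card_image inj_on_def)
        show "inverse ` B \<inter> inverse ` A = {}" using disj by auto
        show "a (p + q - q) = 1" using asm by simp
        show "p + q - k < q" using 3 k by auto
        show "power_sum (q + p) ?e (\<lambda>k. a (p + q - k)) y = 0"
          if y: "y \<in> inverse ` B \<union> inverse ` A" for y
        proof -
          obtain x where x: "x \<in> A \<union> B" "y = inverse x" using y by auto
          then show ?thesis
            using power_sum_reflect[OF pos[OF x(1)], of "p + q" e a] asm
            by (simp add: add.commute)
        qed
      qed
      then show ?thesis using k by simp
    qed
  qed
qed

text \<open>The exponents used are the \<open>p\<close> smallest ones, then \<open>M\<close>, and then \<open>n N, \<dots>, n (N + q - 1)\<close>. A normalised sum of
these powers vanishing at the nodes is $x^M$ minus an interpolant.\<close>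

lemma bounded_interpolation_fixed_split:
  fixes M :: real
  assumes mono: "strict_mono_on {..<2 * N} n" and M: "\<And>j. j < N \<Longrightarrow> n j < M"
      "\<And>j. N \<le> j \<Longrightarrow> j < 2 * N \<Longrightarrow> M < n j"
    and pq: "p \<le> N" "q \<le> N"
  shows "\<exists>K. \<forall>A B. finite A \<and> A \<subseteq> {0<..1} \<and> card A = p \<and> finite B \<and> B \<subseteq> {1<..} \<and> card B = q \<longrightarrow>
    (\<exists>b. (\<forall>j<2 * N. \<bar>b j\<bar> \<le> K) \<and> (\<forall>x\<in>A \<union> B. x powr M = (\<Sum>j<2 * N. b j * x powr n j)))"
proof -
  define e where "e k = (if k < p then n k else if k = p then M else n (N + (k - Suc p)))" for k
  have n_less: "n i < n j" if "i < j" "j < 2 * N" for i j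
    using mono that by (auto simp: strict_mono_on_def)
  have e: "strict_mono_on {..p + q} e"
  proof (rule strict_mono_onI)
    fix i j assume ij: "i \<in> {..p + q}" "j \<in> {..p + q}" "i < j"
    consider "j < p" | "i < p" "j = p" | "i < p" "p < j" | "i = p" | "p < i"
      using ij(3) by linarith
    then show "e i < e j"
      using ij pq by cases (auto simp: e_def intro!: n_less M)
  qed
  obtain K where K: "\<And>a A B k. finite A \<Longrightarrow> A \<subseteq> {0<..1} \<Longrightarrow> card A = p \<Longrightarrow>
    finite B \<Longrightarrow> B \<subseteq> {1<..} \<Longrightarrow> card B = q \<Longrightarrow>
    a p = 1 \<Longrightarrow> (\<And>x. x \<in> A \<union> B \<Longrightarrow> power_sum (p + q) e a x = 0) \<Longrightarrow> k \<le> p + q \<Longrightarrow> \<bar>a k\<bar> \<le> K"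
    using coeffs_bounded[OF e] by metis
  show ?thesis
  proof (intro exI[of _ "max 0 K"] allI impI)
    fix A B :: "real set"
    assume "finite A \<and> A \<subseteq> {0<..1} \<and> card A = p \<and> finite B \<and> B \<subseteq> {1<..} \<and> card B = q"
    then have A: "finite A" "A \<subseteq> {0<..1}" "card A = p" and B: "finite B" "B \<subseteq> {1<..}" "card B = q"
      by auto
    have "A \<inter> B = {}" using A B by fastforce
    then have V: "finite (A \<union> B)" "A \<union> B \<subseteq> {0<..}" "card (A \<union> B) = p + q"
      using A B by (force simp: card_Un_disjoint)+
    obtain a where a: "a p = 1" "\<And>x. x \<in> A \<union> B \<Longrightarrow> power_sum (p + q) e a x = 0"
      using normalized_power_sum_with_zeros[OF e V, of p] by auto
    have aK: "\<bar>a k\<bar> \<le> K" if "k \<le> p + q" for k using K[OF A B a that] .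
    define b where "b j = (if j < p then - a j
       else if N \<le> j \<and> j < N + q then - a (Suc p + (j - N)) else 0)" for j
    have "\<bar>b j\<bar> \<le> max 0 K" for j
      using aK by (auto simp: b_def intro: order_trans[OF _ max.cobounded2])
    moreover have "x powr M = (\<Sum>j<2 * N. b j * x powr n j)" if "x \<in> A \<union> B" for x
    proof -
      have "(\<Sum>j<2 * N. b j * x powr n j) = (\<Sum>j\<in>{..<p} \<union> {N..<N + q}. b j * x powr n j)"
        using pq by (intro sum.mono_neutral_right) (auto simp: b_def)
      also have "\<dots> = (\<Sum>j<p. b j * x powr n j) + (\<Sum>j=N..<N + q. b j * x powr n j)"
        using pq by (intro sum.union_disjoint) auto
      also have "(\<Sum>j<p. b j * x powr n j) = - (\<Sum>k<p. a k * x powr e k)"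
        by (simp add: b_def e_def sum_negf)
      also have "(\<Sum>j=N..<N + q. b j * x powr n j) = - (\<Sum>k=Suc p..<Suc (p + q). a k * x powr e k)"
        unfolding sum_negf[symmetric]
        by (rule sum.reindex_bij_witness[where i = "\<lambda>k. N + (k - Suc p)" and j = "\<lambda>j. Suc p + (j - N)"])
          (use pq in \<open>auto simp: b_def e_def\<close>)
      finally have *: "(\<Sum>j<2 * N. b j * x powr n j)
        = - (\<Sum>k<p. a k * x powr e k) - (\<Sum>k=Suc p..<Suc (p + q). a k * x powr e k)"
        by simp
      have disj: "{..<p} \<inter> {Suc p..<Suc (p + q)} = {}" by auto
      have e_p: "e p = M" by (simp add: e_def)
      have "{..p + q} = insert p ({..<p} \<union> {Suc p..<Suc (p + q)})" by auto
      then have "power_sum (p + q) e a x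
        = x powr M + ((\<Sum>k<p. a k * x powr e k) + (\<Sum>k=Suc p..<Suc (p + q). a k * x powr e k))"
        using a(1) 
        by (simp add: power_sum_def sum.union_disjoint[OF _ _ disj] e_p del: sum.op_ivl_Suc)
      then show ?thesis using a(2)[OF that] * by simp
    qed
    ultimately show "\<exists>b. (\<forall>j<2 * N. \<bar>b j\<bar> \<le> max 0 K) \<and>
        (\<forall>x\<in>A \<union> B. x powr M = (\<Sum>j<2 * N. b j * x powr n j))"
      by blast
  qed
qed

text \<open>The numbers of nodes on either side of $1$ take finitely many values, so the largest of the
corresponding bounds serves for all node sets.\<close>

theorem bounded_interpolation:
  fixes M :: real
  assumes "strict_mono_on {..<2 * N} n" and "\<And>j. j < N \<Longrightarrow> n j < M"
      "\<And>j. N \<le> j \<Longrightarrow> j < 2 * N \<Longrightarrow> M < n j"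
  shows "\<exists>K. \<forall>U. finite U \<and> U \<subseteq> {0<..} \<and> card U \<le> N \<longrightarrow>
    (\<exists>b. (\<forall>j<2 * N. \<bar>b j\<bar> \<le> K) \<and> (\<forall>x\<in>U. x powr M = (\<Sum>j<2 * N. b j * x powr n j)))"
proof -
  define Q where "Q p q K \<longleftrightarrow> (\<forall>A B. finite A \<and> A \<subseteq> {0<..1} \<and> card A = p \<and>
      finite B \<and> B \<subseteq> {1<..} \<and> card B = q \<longrightarrow> (\<exists>b. (\<forall>j<2 * N. \<bar>b j\<bar> \<le> K) \<and>
        (\<forall>x\<in>A \<union> B. x powr M = (\<Sum>j<2 * N. b j * x powr n j))))" for p q K
  have "\<exists>K. Q p q K" if "p \<le> N" "q \<le> N" for p q
    unfolding Q_def using bounded_interpolation_fixed_split[OF assms that] by blast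
  then obtain K where K: "\<And>p q. p \<le> N \<Longrightarrow> q \<le> N \<Longrightarrow> Q p q (K p q)" by metis
  define L where "L = Max ((\<lambda>(p, q). K p q) ` ({..N} \<times> {..N}))"
  have L: "K p q \<le> L" if "p \<le> N" "q \<le> N" for p q
    unfolding L_def using that by (intro Max_ge) auto
  show ?thesis
  proof (intro exI[of _ L] allI impI)
    fix U :: "real set" assume U: "finite U \<and> U \<subseteq> {0<..} \<and> card U \<le> N"
    define A B where "A = {x \<in> U. x \<le> 1}" and "B = {x \<in> U. 1 < x}"
    have AB: "U = A \<union> B" by (auto simp: A_def B_def)
    have card: "card A \<le> N" "card B \<le> N"
      using U card_mono[of U A] card_mono[of U B] by (auto simp: AB)
    have "finite A \<and> A \<subseteq> {0<..1} \<and> card A = card A \<and> finite B \<and> B \<subseteq> {1<..} \<and> card B = card B"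
      using U by (auto simp: A_def B_def)
    from K[OF card, unfolded Q_def, rule_format, OF this] obtain b where "\<forall>j<2 * N. \<bar>b j\<bar> \<le> K (card A) (card B)"
      "\<forall>x\<in>U. x powr M = (\<Sum>j<2 * N. b j * x powr n j)" unfolding AB by blast
    then show "\<exists>b. (\<forall>j<2 * N. \<bar>b j\<bar> \<le> L) \<and> (\<forall>x\<in>U. x powr M = (\<Sum>j<2 * N. b j * x powr n j))"
      using L[OF card] by (meson order_trans)
  qed
qed

section \<open>Entrywise preservers with one negative coefficient\<close>

text \<open>With \<open>g\<close> the power sum in the exponent, the form is $\sum_k c_k g(n_k)^2 - \epsilon g(M)^2$. Interpolation at the
nodes \<open>u i\<close> writes $g(M)$ as a combination of the $g(n_k)$ with coefficients at most \<open>K\<close>, and the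
Cauchy--Schwarz inequality with weights $c_k$ bounds $g(M)^2$ by $S$ times the first sum.\<close>

lemma rank_one_domination:
  fixes n c :: "nat \<Rightarrow> real" and M :: real
  assumes "strict_mono_on {..<2 * N} n" and "\<And>j. j < N \<Longrightarrow> n j < M"
      "\<And>j. N \<le> j \<Longrightarrow> j < 2 * N \<Longrightarrow> M < n j"
    and c: "\<And>j. j < 2 * N \<Longrightarrow> c j > 0"
  shows "\<exists>\<epsilon>\<^sub>0>0. \<forall>\<epsilon> u v. 0 \<le> \<epsilon> \<and> \<epsilon> \<le> \<epsilon>\<^sub>0 \<and> (\<forall>i<N. u i > 0) \<longrightarrow>
    0 \<le> qform N (\<lambda>i j. (\<Sum>k<2 * N. c k * (u i * u j) powr n k) - \<epsilon> * (u i * u j) powr M) v"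
proof -
  obtain K where K: "\<forall>U. finite U \<and> U \<subseteq> {0<..} \<and> card U \<le> N \<longrightarrow>
    (\<exists>b. (\<forall>j<2 * N. \<bar>b j\<bar> \<le> K) \<and> (\<forall>x\<in>U. x powr M = (\<Sum>j<2 * N. b j * x powr n j)))"
  proof -
    have "\<exists>K. \<forall>U. finite U \<and> U \<subseteq> {0<..} \<and> card U \<le> N \<longrightarrow>
      (\<exists>b. (\<forall>j<2 * N. \<bar>b j\<bar> \<le> K) \<and> (\<forall>x\<in>U. x powr M = (\<Sum>j<2 * N. b j * x powr n j)))"
      by (rule bounded_interpolation[OF assms(1)]) (simp_all add: assms(2,3))
    then show ?thesis using that by (elim exE)
  qed
  \<comment> \<open>the summand 1 makes S positive also for N = 0\<close>
  define S where "S = (\<Sum>k<2 * N. K\<^sup>2 / c k) + 1"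
  have "(\<Sum>k<2 * N. K\<^sup>2 / c k) \<ge> 0" using c by (intro sum_nonneg) (simp add: less_imp_le)
  then have S: "S > 0" by (simp add: S_def)
  show ?thesis
  proof (intro exI[of _ "1 / S"] conjI allI impI)
    show "1 / S > 0" using S by simp
  next
    fix \<epsilon> :: real and u v :: "nat \<Rightarrow> real"
    assume "0 \<le> \<epsilon> \<and> \<epsilon> \<le> 1 / S \<and> (\<forall>i<N. u i > 0)"
    then have \<epsilon>: "0 \<le> \<epsilon>" "\<epsilon> \<le> 1 / S" and u: "\<And>i. i < N \<Longrightarrow> u i > 0" by auto
    define g where "g s = (\<Sum>i<N. v i * u i powr s)" for s
    have q: "qform N (\<lambda>i j. (u i * u j) powr s) v = (g s)\<^sup>2" for s
    proof -
      have "qform N (\<lambda>i j. (u i * u j) powr s) v = qform N (\<lambda>i j. u i powr s * u j powr s) v"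
        by (rule qform_cong) (use u in \<open>auto simp: powr_mult less_imp_le\<close>)
      then show ?thesis by (simp add: qform_outer_product g_def)
    qed
    have "finite (u ` {..<N}) \<and> u ` {..<N} \<subseteq> {0<..} \<and> card (u ` {..<N}) \<le> N"
      using u card_image_le[of "{..<N}" u] by auto
    from K[rule_format, OF this] obtain b where b: "\<forall>k<2 * N. \<bar>b k\<bar> \<le> K"
      "\<forall>x\<in>u ` {..<N}. x powr M = (\<Sum>k<2 * N. b k * x powr n k)"
      by blast
    have "g M = (\<Sum>i<N. \<Sum>k<2 * N. b k * (v i * u i powr n k))"
      by (simp add: g_def b(2) sum_distrib_left mult_ac)
    also have "\<dots> = (\<Sum>k<2 * N. b k * g (n k))"
      by (subst sum.swap) (simp add: g_def sum_distrib_left)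
    also have "\<dots> = (\<Sum>k<2 * N. (b k / sqrt (c k)) * (sqrt (c k) * g (n k)))"
    proof (intro sum.cong refl)
      fix k assume "k \<in> {..<2 * N}"
      then have "sqrt (c k) \<noteq> 0" using c[of k] by simp
      then show "b k * g (n k) = b k / sqrt (c k) * (sqrt (c k) * g (n k))" by simp
    qed
    finally have "(g M)\<^sup>2 \<le> (\<Sum>k<2 * N. (b k / sqrt (c k))\<^sup>2) * (\<Sum>k<2 * N. (sqrt (c k) * g (n k))\<^sup>2)"
      by (simp only: Cauchy_Schwarz_ineq_sum)
    also have "(\<Sum>k<2 * N. (sqrt (c k) * g (n k))\<^sup>2) = (\<Sum>k<2 * N. c k * (g (n k))\<^sup>2)"
      using c by (intro sum.cong) (auto simp: power_mult_distrib less_imp_le)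
    also have "(\<Sum>k<2 * N. (b k / sqrt (c k))\<^sup>2) * (\<Sum>k<2 * N. c k * (g (n k))\<^sup>2)
      \<le> S * (\<Sum>k<2 * N. c k * (g (n k))\<^sup>2)"
    proof (rule mult_right_mono)
      have "(b k / sqrt (c k))\<^sup>2 \<le> K\<^sup>2 / c k" if "k < 2 * N" for k
        using power_mono[OF b(1)[rule_format, OF that] abs_ge_zero, of 2] c[OF that]
        by (simp add: power_divide divide_right_mono)
      then have "(\<Sum>k<2 * N. (b k / sqrt (c k))\<^sup>2) \<le> (\<Sum>k<2 * N. K\<^sup>2 / c k)"
        by (intro sum_mono) simp
      then show "(\<Sum>k<2 * N. (b k / sqrt (c k))\<^sup>2) \<le> S" by (simp add: S_def)
      show "0 \<le> (\<Sum>k<2 * N. c k * (g (n k))\<^sup>2)"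
        using c by (intro sum_nonneg) (simp add: less_imp_le)
    qed
    finally have "(g M)\<^sup>2 / S \<le> (\<Sum>k<2 * N. c k * (g (n k))\<^sup>2)"
      using S by (simp add: pos_divide_le_eq mult.commute)
    moreover have "\<epsilon> * (g M)\<^sup>2 \<le> (g M)\<^sup>2 / S"
      using mult_right_mono[OF \<epsilon>(2), of "(g M)\<^sup>2"] by simp
    moreover have "qform N (\<lambda>i j. (\<Sum>k<2 * N. c k * (u i * u j) powr n k) + (- \<epsilon>) * (u i * u j) powr M) v
        = (\<Sum>k<2 * N. c k * (g (n k))\<^sup>2) - \<epsilon> * (g M)\<^sup>2"
      by (simp only: qform_add qform_sum qform_scale q)
    ultimately show "0 \<le> qform N
        (\<lambda>i j. (\<Sum>k<2 * N. c k * (u i * u j) powr n k) - \<epsilon> * (u i * u j) powr M) v"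
      by simp
  qed
qed

text \<open>Below the threshold \<open>T\<close> all exponents are distinct natural numbers in increasing order, so the one with index
\<open>j\<close> is at least \<open>j\<close>. This makes the largest of the lower exponents reach the FitzGerald--Horn threshold
even when it is not an integer.\<close>

lemma admissible_exponent_lower_bound:
  fixes n :: "nat \<Rightarrow> real"
  assumes "strict_mono_on {..<k} n" and "\<And>j. j < k \<Longrightarrow> n j \<in> \<nat> \<or> n j \<ge> T" and "j < k"
  shows "n j \<ge> real j \<or> n j \<ge> T"
  using assms(3)
proof (induction j)
  case 0
  then show ?case using assms(2)[of 0] by (auto simp: Nats_def)
next
  case (Suc j)
  have less: "n j < n (Suc j)" using assms(1) Suc.prems by (auto simp: strict_mono_on_def)
  show ?case
  proof (cases "n (Suc j) \<ge> T")
    case False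
    then have nj: "n j \<ge> real j" using Suc less by auto
    obtain i where i: "n (Suc j) = real i"
      using assms(2)[OF Suc.prems] False by (auto elim: Nats_cases)
    have "real j < real i" using nj less i by linarith
    then show ?thesis using i by simp
  qed simp
qed

text \<open>The bound is stated for a whole interval of values of \<open>\<epsilon>\<close> because in the induction step the derivative carries
the factor $\epsilon M$. The derivative has one exponent too many on either side of \<open>M\<close>: the smallest and the largest
one, with index \<open>t\<close>, are split off and preserve positivity by themselves, and the remaining
exponents, lowered by $1$, satisfy the hypotheses in dimension \<open>N\<close>.\<close>

theorem negative_coefficient_preserver:
  fixes n c :: "nat \<Rightarrow> real" and M :: real
  assumes "strict_mono_on {..<2 * N} n" and "\<And>j. j < N \<Longrightarrow> n j < M"
      "\<And>j. N \<le> j \<Longrightarrow> j < 2 * N \<Longrightarrow> M < n j"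
    and "\<And>j. j < N \<Longrightarrow> n j \<in> \<nat> \<or> n j \<ge> real N - 2"
    and "\<And>j. j < 2 * N \<Longrightarrow> c j > 0"
  shows "\<exists>\<epsilon>\<^sub>0>0. \<forall>\<epsilon>. 0 \<le> \<epsilon> \<and> \<epsilon> \<le> \<epsilon>\<^sub>0 \<longrightarrow>
    preserves_psd N (\<lambda>x. (\<Sum>j<2 * N. c j * x powr n j) - \<epsilon> * x powr M)"
  using assms
proof (induction N arbitrary: n c M)
  case 0
  show ?case by (intro exI[of _ 1]) simp
next
  case (Suc N)
  have n_less: "n i < n j" if "i < j" "j < 2 * Suc N" for i j
    using Suc.prems(1) that by (auto simp: strict_mono_on_def)
  obtain \<epsilon>\<^sub>1 where \<epsilon>\<^sub>1: "\<epsilon>\<^sub>1 > 0" "\<And>\<epsilon> u v. 0 \<le> \<epsilon> \<Longrightarrow> \<epsilon> \<le> \<epsilon>\<^sub>1 \<Longrightarrow> (\<And>i. i < Suc N \<Longrightarrow> u i > 0) \<Longrightarrow>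
    0 \<le> qform (Suc N) (\<lambda>i j. (\<Sum>k<2 * Suc N. c k * (u i * u j) powr n k) - \<epsilon> * (u i * u j) powr M) v"
    using rank_one_domination[where N = "Suc N" and n = n and c = c and M = M, OF Suc.prems(1-3,5)]
    by blast
  define f' where "f' \<epsilon> x = (\<Sum>j<2 * Suc N. c j * (n j * x powr (n j - 1))) - \<epsilon> * (M * x powr (M - 1))"
    for \<epsilon> x
  have "\<exists>\<epsilon>\<^sub>2>0. \<forall>\<epsilon>. 0 \<le> \<epsilon> \<and> \<epsilon> \<le> \<epsilon>\<^sub>2 \<longrightarrow> preserves_psd N (f' \<epsilon>)"
  proof (cases "N = 0")
    case True
    then show ?thesis by (intro exI[of _ 1]) simp
  next
    case False
    have n0: "n 0 \<ge> 0"
      using Suc.prems(4)[of 0] False by (auto simp: Nats_def)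
    have n_pos: "n j > 0" if "0 < j" "j < 2 * Suc N" for j
      using n_less[OF that] n0 by simp
    have M: "M > 0" using Suc.prems(2)[of 0] n0 by simp
    have shifted: "n j - 1 \<in> \<nat> \<or> n j - 1 \<ge> real N - 2" if "j < Suc N" "n j \<noteq> 0" for j
      using Suc.prems(4)[OF that(1)] Nats_diff_one that(2) by auto
    have "\<exists>\<epsilon>\<^sub>0>0. \<forall>\<epsilon>. 0 \<le> \<epsilon> \<and> \<epsilon> \<le> \<epsilon>\<^sub>0 \<longrightarrow> preserves_psd N
      (\<lambda>x. (\<Sum>j<2 * N. (c (Suc j) * n (Suc j)) * x powr (n (Suc j) - 1)) - \<epsilon> * x powr (M - 1))"
    proof (rule Suc.IH)
      show "strict_mono_on {..<2 * N} (\<lambda>j. n (Suc j) - 1)"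
        by (auto simp: strict_mono_on_def intro!: n_less)
      show "n (Suc j) - 1 < M - 1" if "j < N" for j using Suc.prems(2)[of "Suc j"] that by simp
      show "M - 1 < n (Suc j) - 1" if "N \<le> j" "j < 2 * N" for j
        using Suc.prems(3)[of "Suc j"] that by simp
      show "n (Suc j) - 1 \<in> \<nat> \<or> n (Suc j) - 1 \<ge> real N - 2" if "j < N" for j
        using shifted[of "Suc j"] n_pos[of "Suc j"] that by simp
      show "c (Suc j) * n (Suc j) > 0" if "j < 2 * N" for j
        using Suc.prems(5)[of "Suc j"] n_pos[of "Suc j"] that by simp
    qed
    then obtain \<epsilon>\<^sub>0 where \<epsilon>\<^sub>0: "\<epsilon>\<^sub>0 > 0" "\<And>\<epsilon>. 0 \<le> \<epsilon> \<Longrightarrow> \<epsilon> \<le> \<epsilon>\<^sub>0 \<Longrightarrow> preserves_psd N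
      (\<lambda>x. (\<Sum>j<2 * N. (c (Suc j) * n (Suc j)) * x powr (n (Suc j) - 1)) - \<epsilon> * x powr (M - 1))"
      by blast
    have bottom: "preserves_psd N (\<lambda>x. (c 0 * n 0) * x powr (n 0 - 1))"
    proof (cases "n 0 = 0")
      case True
      then show ?thesis by (simp add: preserves_psd_def real_psd_def qform_def)
    next
      case False
      then show ?thesis
        using shifted[of 0] n0 Suc.prems(5)[of 0] by (intro preserves_psd_scale preserves_psd_powr) auto
    qed
    define t where "t = Suc (2 * N)"
    have top: "preserves_psd N (\<lambda>x. (c t * n t) * x powr (n t - 1))"
    proof (intro preserves_psd_scale preserves_psd_powr)
      have "strict_mono_on {..<Suc N} n" by (auto simp: strict_mono_on_def intro!: n_less)
      then have "n N \<ge> real N \<or> n N \<ge> real (Suc N) - 2"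
        using admissible_exponent_lower_bound[of "Suc N" n "real (Suc N) - 2" N] Suc.prems(4) by simp
      then show "n t - 1 \<in> \<nat> \<or> n t - 1 \<ge> real N - 2"
        using n_less[of N t] by (auto simp: t_def)
      show "c t * n t \<ge> 0" using n_pos[of t] Suc.prems(5)[of t] by (simp add: t_def)
    qed
    show ?thesis
    proof (intro exI[of _ "\<epsilon>\<^sub>0 / M"] conjI allI impI)
      show "\<epsilon>\<^sub>0 / M > 0" using \<epsilon>\<^sub>0(1) M by simp
    next
      fix \<epsilon> assume "0 \<le> \<epsilon> \<and> \<epsilon> \<le> \<epsilon>\<^sub>0 / M"
      then have "0 \<le> \<epsilon> * M" "\<epsilon> * M \<le> \<epsilon>\<^sub>0" using M by (auto simp: pos_le_divide_eq)
      note preserves_psd_add[OF preserves_psd_add[OF \<epsilon>\<^sub>0(2)[OF this] bottom] top]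
      moreover have split: "(\<Sum>j<2 * Suc N. g j) = g 0 + (\<Sum>j<2 * N. g (Suc j)) + g t" for g :: "nat \<Rightarrow> real"
      proof -
        have "(\<Sum>j<2 * Suc N. g j) = (\<Sum>j<t. g j) + g t" by (simp add: t_def)
        then show ?thesis unfolding t_def sum.lessThan_Suc_shift .
      qed
      have "f' \<epsilon> = (\<lambda>x. (\<Sum>j<2 * N. (c (Suc j) * n (Suc j)) * x powr (n (Suc j) - 1))
          - (\<epsilon> * M) * x powr (M - 1) + (c 0 * n 0) * x powr (n 0 - 1) + (c t * n t) * x powr (n t - 1))"
        by (intro ext) (simp only: f'_def split, simp add: mult_ac)
      ultimately show "preserves_psd N (f' \<epsilon>)" by simp
    qed
  qed
  then obtain \<epsilon>\<^sub>2 where \<epsilon>\<^sub>2: "\<epsilon>\<^sub>2 > 0" "\<And>\<epsilon>. 0 \<le> \<epsilon> \<Longrightarrow> \<epsilon> \<le> \<epsilon>\<^sub>2 \<Longrightarrow> preserves_psd N (f' \<epsilon>)" by blast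
  show ?case
  proof (intro exI[of _ "min \<epsilon>\<^sub>1 \<epsilon>\<^sub>2"] conjI allI impI)
    show "min \<epsilon>\<^sub>1 \<epsilon>\<^sub>2 > 0" using \<epsilon>\<^sub>1(1) \<epsilon>\<^sub>2(1) by simp
  next
    fix \<epsilon> assume \<epsilon>: "0 \<le> \<epsilon> \<and> \<epsilon> \<le> min \<epsilon>\<^sub>1 \<epsilon>\<^sub>2"
    show "preserves_psd (Suc N) (\<lambda>x. (\<Sum>j<2 * Suc N. c j * x powr n j) - \<epsilon> * x powr M)"
    proof (rule preserves_psd_Suc)
      show "((\<lambda>x. (\<Sum>j<2 * Suc N. c j * x powr n j) - \<epsilon> * x powr M) has_real_derivative f' \<epsilon> x) (at x)"
        if "x > 0" for x
      proof -
        have "((\<lambda>x. x powr s) has_real_derivative s * x powr (s - 1)) (at x)" for s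
          using that by (auto intro!: derivative_eq_intros)
        then show ?thesis unfolding f'_def by (intro DERIV_diff DERIV_sum DERIV_cmult)
      qed
    qed (use \<epsilon> \<epsilon>\<^sub>1(2) \<epsilon>\<^sub>2(2) in auto)
  qed
qed

section \<open>From real quadratic forms to complex Hermitian matrices\<close>

lemma mat_adjoint_index:
  "A \<in> carrier_mat N N \<Longrightarrow> i < N \<Longrightarrow> j < N \<Longrightarrow> mat_adjoint A $$ (i, j) = conjugate (A $$ (j, i))"
  by (simp add: mat_adjoint_def mat_of_rows_index)

text \<open>For real symmetric matrices the Hermitian form at $v$ is the sum of the real forms at the real and
imaginary parts of $v$.\<close>

lemma psd_mat_of_real_iff:
  "psd_mat N (mat N N (\<lambda>(i, j). complex_of_real (B i j))) \<longleftrightarrow> real_psd N B"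
proof -
  let ?A = "mat N N (\<lambda>(i, j). complex_of_real (B i j))"
  have A: "?A \<in> carrier_mat N N" by simp
  have adj: "mat_adjoint ?A = ?A \<longleftrightarrow> (\<forall>i<N. \<forall>j<N. B i j = B j i)"
  proof -
    have "dim_row (mat_adjoint ?A) = N" "dim_col (mat_adjoint ?A) = N"
      by (simp_all add: mat_adjoint_def)
    then show ?thesis
      by (auto simp: mat_eq_iff mat_adjoint_index[OF A])
  qed
  have q: "Re ((?A *\<^sub>v v) \<bullet>c v) = qform N B (\<lambda>i. Re (v $ i)) + qform N B (\<lambda>i. Im (v $ i))"
    if "v \<in> carrier_vec N" for v
  proof -
    have "(?A *\<^sub>v v) \<bullet>c v = (\<Sum>i<N. (\<Sum>j<N. complex_of_real (B i j) * v $ j) * cnj (v $ i))"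
      using that by (simp add: scalar_prod_def lessThan_atLeast0)
    also have "Re \<dots> = (\<Sum>i<N. \<Sum>j<N. Re (v $ i) * Re (v $ j) * B i j + Im (v $ i) * Im (v $ j) * B i j)"
      by (simp only: sum_distrib_right Re_sum, intro sum.cong refl) (simp add: algebra_simps)
    finally show ?thesis by (simp add: qform_def sum.distrib)
  qed
  have "(\<forall>v\<in>carrier_vec N. 0 \<le> Re ((?A *\<^sub>v v) \<bullet>c v)) \<longleftrightarrow> (\<forall>w. 0 \<le> qform N B w)"
  proof
    assume *: "\<forall>v\<in>carrier_vec N. 0 \<le> Re ((?A *\<^sub>v v) \<bullet>c v)"
    show "\<forall>w. 0 \<le> qform N B w"
    proof
      fix w
      let ?v = "vec N (\<lambda>i. complex_of_real (w i))"
      have "qform N B (\<lambda>i. Re (?v $ i)) = qform N B w" "qform N B (\<lambda>i. Im (?v $ i)) = qform N B (\<lambda>_. 0)"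
        by (rule qform_cong; simp)+
      moreover have "qform N B (\<lambda>_. 0) = 0" by (simp add: qform_def)
      moreover have "0 \<le> Re ((?A *\<^sub>v ?v) \<bullet>c ?v)" using * by simp
      ultimately show "0 \<le> qform N B w" using q[of ?v] by simp
    qed
  qed (simp add: q)
  then show ?thesis
    unfolding psd_mat_def real_psd_def using A adj by simp
qed

text \<open>A matrix in the domain has positive real entries, so it is the complexification of a real matrix.\<close>

theorem entrywise_preserves_positivityI:
  assumes f: "preserves_psd N f"
    and F: "\<And>x. x > 0 \<Longrightarrow> F (complex_of_real x) = complex_of_real (f x)"
  shows "entrywise_preserves_positivity N (complex_of_real ` {0<..}) F"
  unfolding entrywise_preserves_positivity_def
proof
  fix A assume "A \<in> psd_with_entries N (complex_of_real ` {0<..})"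
  then have psd: "psd_mat N A" and el: "elements_mat A \<subseteq> complex_of_real ` {0<..}"
    by (auto simp: psd_with_entries_def)
  then have A: "A \<in> carrier_mat N N" by (simp add: psd_mat_def)
  define B where "B i j = Re (A $$ (i, j))" for i j
  have B: "A $$ (i, j) = complex_of_real (B i j) \<and> B i j > 0" if "i < N" "j < N" for i j
  proof -
    have "A $$ (i, j) \<in> elements_mat A" using A that by blast
    then show ?thesis using el by (auto simp: B_def)
  qed
  have "A = mat N N (\<lambda>(i, j). complex_of_real (B i j))"
    by (rule eq_matI) (use A B in auto)
  then have "real_psd N B" using psd psd_mat_of_real_iff by metis
  then have "real_psd N (\<lambda>i j. f (B i j))" using f B by (simp add: preserves_psd_def)
  moreover have "map_mat F A = mat N N (\<lambda>(i, j). complex_of_real (f (B i j)))"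
    by (rule eq_matI) (use A B F in auto)
  ultimately show "psd_mat N (map_mat F A)" by (simp add: psd_mat_of_real_iff)
qed

theorem theorem5p7:
  fixes N :: nat and n c :: "nat \<Rightarrow> real" and M :: real
  assumes "N > 0"
    and "0 \<le> n 0"
    and "strict_mono_on {..<2 * N} n"
    and "n (N - 1) < M" and "M < n N"
    and "\<And>j. j < N - 1 \<Longrightarrow> n j \<in> \<nat> \<or> n j > real N - 2"
    and "\<And>j. j < 2 * N \<Longrightarrow> c j > 0"
  shows "\<exists>cM::real. cM < 0 \<and>
    entrywise_preserves_positivity N (complex_of_real ` {0<..})
      (\<lambda>x. (\<Sum>j<N. complex_of_real (c j) * x powr complex_of_real (n j))
          + complex_of_real cM * x powr complex_of_real M
          + (\<Sum>j=N..<2 * N. complex_of_real (c j) * x powr complex_of_real (n j)))"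
proof -
  have n_less: "n i < n j" if "i < j" "j < 2 * N" for i j
    using assms(3) that by (auto simp: strict_mono_on_def)
  \<comment> \<open>the exponent without a hypothesis of its own is pushed up by the smaller ones\<close>
  have n_last: "n (N - 1) \<ge> real N - 2"
  proof (cases "N = 1")
    case True
    then show ?thesis using assms(2) by simp
  next
    case False
    have "strict_mono_on {..<N - 1} n" by (auto simp: strict_mono_on_def intro!: n_less)
    then have "n (N - 2) \<ge> real (N - 2) \<or> n (N - 2) \<ge> real N - 2"
      by (rule admissible_exponent_lower_bound) (use assms(1,6) False in \<open>force+\<close>)
    then have "n (N - 2) \<ge> real N - 2" using assms(1) False by (auto simp: of_nat_diff)
    moreover have "n (N - 2) < n (N - 1)" using assms(1) False by (intro n_less) auto
    ultimately show ?thesis by simp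
  qed
  have "\<exists>\<epsilon>\<^sub>0>0. \<forall>\<epsilon>. 0 \<le> \<epsilon> \<and> \<epsilon> \<le> \<epsilon>\<^sub>0 \<longrightarrow>
    preserves_psd N (\<lambda>x. (\<Sum>j<2 * N. c j * x powr n j) - \<epsilon> * x powr M)"
  proof (rule negative_coefficient_preserver)
    have n_mono: "n i \<le> n j" if "i \<le> j" "j < 2 * N" for i j
      using n_less[of i j] that by (cases "i = j") auto
    show "n j < M" if "j < N" for j
      by (rule le_less_trans[OF n_mono[of j "N - 1"] assms(4)]) (use that in auto)
    show "M < n j" if "N \<le> j" "j < 2 * N" for j
      by (rule less_le_trans[OF assms(5) n_mono[OF that]])
    show "n j \<in> \<nat> \<or> n j \<ge> real N - 2" if "j < N" for j
      using assms(6)[of j] n_last that by (cases "j = N - 1") auto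
  qed (use assms in auto)
  then obtain \<epsilon> where \<epsilon>: "\<epsilon> > 0"
    "preserves_psd N (\<lambda>x. (\<Sum>j<2 * N. c j * x powr n j) - \<epsilon> * x powr M)"
    by (meson less_imp_le order_refl)
  have split: "(\<Sum>j<2 * N. g j) = (\<Sum>j<N. g j) + (\<Sum>j=N..<2 * N. g j)" for g :: "nat \<Rightarrow> real"
    using sum.atLeastLessThan_concat[of 0 N "2 * N" g] by (simp add: lessThan_atLeast0)
  show ?thesis
    by (intro exI[of _ "- \<epsilon>"] conjI entrywise_preserves_positivityI[OF \<epsilon>(2)])
      (use \<epsilon>(1) in \<open>simp_all add: split powr_of_real less_imp_le\<close>)
qed

end
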